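(* Let $H$ be an $n\times n$ Hermitian matrix with $n\geq 7$. Then $H$ is $(n-3)$-spectrally monomorphic if and only if $H$ is $\Gamma$-equivalent to $H_n(c)$ for some complex number $c$, or $H$ is $\Gamma$-equivalent to $iS$ for some $n\times n$ skew-symmetric conference matrix $S$ (here $i$ is the imaginary unit).
   Context: For an $n\times n$ complex matrix $A$ and $\alpha\subseteq\{1,\ldots,n\}$, $A[\alpha]$ denotes the principal submatrix of $A$ with rows and columns indexed by $\alpha$. The matrix $A$ is $k$-spectrally monomorphic if all its $k\times k$ principal submatrices $A[\alpha]$, $|\alpha|=k$, have the same characteristic polynomial. Let $\Gamma$ be the subgroup of $GL_n(\mathbb{C})$ generated by the unitary diagonal matrices (diagonal matrices whose diagonal entries have modulus $1$) and the permutation matrices. Two $n\times n$ Hermitian matrices $H_1,H_2$ are $\Gamma$-equivalent if $H_2=a(SH_1S^{*})+bI$ for some real numbers $a\neq 0$ and $b$ and some $S\in\Gamma$. This is an equivalence relation. For a complex number $c$, $H_n(c)$ is the $n\times n$ Hermitian matrix with zero diagonal, all entries strictly above the diagonal equal to $c$, and all entries strictly below the diagonal equal to $\overline{c}$. A conference matrix is an $n\times n$ matrix $C$ with $0$ on the diagonal and entries $1$ and $-1$ off the diagonal such that $C^{t}C=(n-1)I_n$. A skew-symmetric conference matrix is a conference matrix $S$ with $S^{t}=-S$. *)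

theory Defs
  imports
    "HOL-Algebra.Generated_Groups"
    "Jordan_Normal_Form.Char_Poly"
    "Jordan_Normal_Form.Schur_Decomposition"
    "Jordan_Normal_Form.DL_Submatrix"
begin

(* Rows and columns are indexed by {0..<n} instead of {1..n}. *)

definition hermitian_mat :: "nat \<Rightarrow> complex mat \<Rightarrow> bool" where
  "hermitian_mat n H \<longleftrightarrow> H \<in> carrier_mat n n \<and> mat_adjoint H = H"

definition spectrally_monomorphic :: "nat \<Rightarrow> nat \<Rightarrow> complex mat \<Rightarrow> bool" where
  "spectrally_monomorphic n k A \<longleftrightarrow>
     (\<forall>\<alpha> \<beta>. \<alpha> \<subseteq> {0..<n} \<longrightarrow> card \<alpha> = k \<longrightarrow> \<beta> \<subseteq> {0..<n} \<longrightarrow> card \<beta> = k \<longrightarrow>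
        char_poly (submatrix A \<alpha> \<alpha>) = char_poly (submatrix A \<beta> \<beta>))"

definition GL_mat :: "nat \<Rightarrow> complex mat monoid" where
  "GL_mat n = units_of (ring_mat TYPE(complex) n ())"

definition unitary_diagonal_mats :: "nat \<Rightarrow> complex mat set" where
  "unitary_diagonal_mats n =
     {D \<in> carrier_mat n n. diagonal_mat D \<and> (\<forall>i<n. cmod (D $$ (i,i)) = 1)}"

definition permutation_mats :: "nat \<Rightarrow> complex mat set" where
  "permutation_mats n =
     {mat n n (\<lambda>(i,j). if i = p j then 1 else 0) | p. p permutes {0..<n}}"

definition Gamma_group :: "nat \<Rightarrow> complex mat set" where
  "Gamma_group n = generate (GL_mat n) (unitary_diagonal_mats n \<union> permutation_mats n)"

definition Gamma_equivalent :: "nat \<Rightarrow> complex mat \<Rightarrow> complex mat \<Rightarrow> bool" where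
  "Gamma_equivalent n H1 H2 \<longleftrightarrow>
     hermitian_mat n H1 \<and> hermitian_mat n H2 \<and>
     (\<exists>(a::real) (b::real). \<exists>S\<in>Gamma_group n. a \<noteq> 0 \<and>
        H2 = complex_of_real a \<cdot>\<^sub>m (S * H1 * mat_adjoint S) + complex_of_real b \<cdot>\<^sub>m 1\<^sub>m n)"

definition Hn :: "nat \<Rightarrow> complex \<Rightarrow> complex mat" where
  "Hn n c = mat n n (\<lambda>(i,j). if i = j then 0 else if i < j then c else cnj c)"

definition conference_mat :: "nat \<Rightarrow> complex mat \<Rightarrow> bool" where
  "conference_mat n C \<longleftrightarrow> C \<in> carrier_mat n n \<and>
     (\<forall>i<n. C $$ (i,i) = 0) \<and>
     (\<forall>i<n. \<forall>j<n. i \<noteq> j \<longrightarrow> C $$ (i,j) \<in> {1, -1}) \<and>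
     transpose_mat C * C = of_nat (n - 1) \<cdot>\<^sub>m 1\<^sub>m n"

definition skew_conference_mat :: "nat \<Rightarrow> complex mat \<Rightarrow> bool" where
  "skew_conference_mat n S \<longleftrightarrow> conference_mat n S \<and> transpose_mat S = - S"

end

theory Submission
  imports Defs "HOL-Combinatorics.Multiset_Permutations"
begin

text \<open>The matrices \<open>Hn n c\<close> are monomorphic because deleting the same rows and columns leaves a matrix
of the same shape. For a skew conference matrix \<open>S\<close>, the identity
\<open>(x I - \<i> S) (x I + \<i> S) = (x^2 - (n - 1)) I\<close> lets Jacobi's identity for complementary minors
express the characteristic polynomial of every principal submatrix of order \<open>n - 3\<close> of \<open>\<i> S\<close> by
the one of \<open>\<i> S\<close> and a principal minor of order 3 of \<open>x I + \<i> S\<close>; the latter is always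
\<open>x^3 - 3 x\<close> (\<open>char_poly_principal_skew_conference\<close>). Both properties are transported along the
action of the monomial unitary matrices, which changes all characteristic polynomials by one and the
same affine substitution.

Conversely, the traces of the powers of \<open>H[\<alpha>]\<close> are determined by its characteristic polynomial, and
they are sums of weights of closed walks inside \<open>\<alpha>\<close>. Hence, for every length \<open>j \<le> 4\<close>, the total
weight \<open>F(\<alpha>)\<close> of the closed walks in \<open>\<alpha>\<close> with \<open>j\<close> distinct vertices is the same for all \<open>\<alpha>\<close> of
size \<open>n - 3\<close>; once the diagonal is 0 and the other entries have one modulus, the walks that repeat
a vertex contribute a constant only. By double counting \<open>F\<close>
is then constant on all sets of any fixed larger size, and by inclusion and exclusion the total
weight of the walks through a given set of at most three vertices does not depend on that set
(\<open>word_sum_design\<close>): a 3-design with weights. This is where \<open>n - 3\<close> enters, and \<open>n \<ge> 7\<close> gives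
\<open>4 \<le> n - 3\<close>.

Length 1 shows that the diagonal is constant, so that it can be shifted to 0. Length 2 shows that
all other entries have one modulus, and length 3 that
\<open>Re (h x y * h y z * h z x)\<close> is constant. After multiplication by a diagonal unitary matrix row 0
equals \<open>c\<close> off the diagonal and all other entries are \<open>c\<close> or its conjugate, which
is \<open>Hn n c\<close> if \<open>c\<close> is real and a tournament otherwise (\<open>switching_normal_form\<close>). If this
tournament is transitive, sorting it gives \<open>Hn n c\<close>. If
it has a cyclic triangle, the constancy in length 3 compares \<open>Re (c^3)\<close> with \<open>Re (c * c * cnj c)\<close> and
forces \<open>c\<close> to be purely imaginary, so \<open>H\<close> is a multiple of \<open>\<i> S\<close> with \<open>S\<close> skew and entries \<open>\<plusminus>1\<close>.
Length 4 then says that every edge between the vertices other than 0 lies in equally many, say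
\<open>m > 0\<close>, cyclic triangles. Counting the cyclic triangles at a vertex through their outgoing and
through their incoming edges yields
\<open>m * outdegree = m * indegree\<close>, so the tournament is regular, and then the rows of \<open>S\<close> are
orthogonal (\<open>balanced_of_cyclic_design\<close>).\<close>

section \<open>Principal submatrices as reindexed matrices\<close>

text \<open>Principal submatrices are handled through arbitrary injections \<open>f\<close> into the index set, instead of
increasing enumerations of subsets: this class is closed under composition with permutations.\<close>

definition reindex_mat :: "nat \<Rightarrow> 'a mat \<Rightarrow> (nat \<Rightarrow> nat) \<Rightarrow> 'a mat" where
  "reindex_mat k A f = mat k k (\<lambda>(i,j). A $$ (f i, f j))"

lemma reindex_mat_carrier [simp]: "reindex_mat k A f \<in> carrier_mat k k"
  by (simp add: reindex_mat_def)

lemma reindex_mat_dim [simp]: "dim_row (reindex_mat k A f) = k" "dim_col (reindex_mat k A f) = k"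
  by (simp_all add: reindex_mat_def)

lemma reindex_mat_index [simp]:
  "i < k \<Longrightarrow> j < k \<Longrightarrow> reindex_mat k A f $$ (i,j) = A $$ (f i, f j)"
  by (simp add: reindex_mat_def)

lemma poly_char_poly_eq_det:
  fixes A :: "'a :: field mat"
  assumes "A \<in> carrier_mat k k"
  shows "poly (char_poly A) x = det (mat k k (\<lambda>(i,j). (if i = j then x else 0) - A $$ (i,j)))"
  unfolding char_poly_def
  by (rule poly_det_cong[of _ k]) (use assms in \<open>auto simp: char_poly_matrix_def\<close>)

lemma poly_ext:
  fixes p q :: "complex poly"
  assumes "\<And>x. poly p x = poly q x"
  shows "p = q"
  using assms by (simp add: poly_eq_poly_eq_iff[symmetric] fun_eq_iff)

lemma det_reindex_permutes:
  fixes A :: "'a :: comm_ring_1 mat"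
  assumes A: "A \<in> carrier_mat k k" and p: "p permutes {0..<k}"
  shows "det (reindex_mat k A p) = det A"
proof -
  define B where "B = mat k k (\<lambda>(i,j). A $$ (p i, j))"
  have B: "B \<in> carrier_mat k k" by (simp add: B_def)
  have pk: "p i < k" if "i < k" for i
    using permutes_in_image[OF p, of i] that by simp
  have "transpose_mat (reindex_mat k A p) = mat k k (\<lambda>(i,j). transpose_mat B $$ (p i, j))"
    by (rule eq_matI) (auto simp: B_def pk)
  then have "det (transpose_mat (reindex_mat k A p)) = signof p * det (transpose_mat B)"
    using det_permute_rows[OF _ p, of "transpose_mat B"] B by simp
  moreover have "det B = signof p * det A"
    unfolding B_def by (rule det_permute_rows[OF A p])
  ultimately have "det (reindex_mat k A p) = signof p * (signof p * det A)"
    using det_transpose[OF reindex_mat_carrier, of k A p] det_transpose[OF B] by simp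
  then show ?thesis
    by (simp add: sign_def split: if_splits)
qed

text \<open>Two enumerations of the same set differ by a permutation, which permutes rows and columns of the
characteristic matrix simultaneously, so the sign of the permutation occurs twice.\<close>

lemma char_poly_reindex_same_image:
  fixes A :: "'a :: comm_ring_1 mat"
  assumes f: "inj_on f {0..<k}" and g: "inj_on g {0..<k}"
    and im: "f ` {0..<k} = g ` {0..<k}"
  shows "char_poly (reindex_mat k A f) = char_poly (reindex_mat k A g)"
proof -
  define t where "t i = (if i < k then inv_into {0..<k} g (f i) else i)" for i
  have gt: "g (t i) = f i" "t i < k" if "i < k" for i
  proof -
    have "f i \<in> g ` {0..<k}" using im that by auto
    then show "g (t i) = f i" "t i < k"
      using that f_inv_into_f[of "f i" g "{0..<k}"] inv_into_into[of "f i" g "{0..<k}"]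
      by (auto simp: t_def)
  qed
  have "inj_on t {0..<k}"
    by (rule inj_onI) (metis atLeastLessThan_iff f gt(1) inj_on_contraD)
  moreover have "t ` {0..<k} \<subseteq> {0..<k}" using gt by auto
  ultimately have "bij_betw t {0..<k} {0..<k}"
    by (simp add: bij_betw_def endo_inj_surj)
  then have t: "t permutes {0..<k}"
    by (rule bij_imp_permutes) (auto simp: t_def)
  have teq: "t i = t j \<longleftrightarrow> i = j" for i j
    using permutes_inj[OF t] by (auto dest: injD)
  have "char_poly_matrix (reindex_mat k A f) = reindex_mat k (char_poly_matrix (reindex_mat k A g)) t"
    by (rule eq_matI) (auto simp: char_poly_matrix_def gt teq)
  then show ?thesis
    unfolding char_poly_def by (simp add: det_reindex_permutes[OF _ t, of "char_poly_matrix (reindex_mat k A g)"])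
qed

lemma submatrix_eq_reindex:
  assumes A: "A \<in> carrier_mat n n" and a: "\<alpha> \<subseteq> {0..<n}" and c: "card \<alpha> = k"
  obtains f where "inj_on f {0..<k}" "f ` {0..<k} = \<alpha>" "submatrix A \<alpha> \<alpha> = reindex_mat k A f"
proof
  have fin: "finite \<alpha>" using a finite_subset by blast
  have s: "{i. i < n \<and> i \<in> \<alpha>} = \<alpha>" using a by auto
  show "submatrix A \<alpha> \<alpha> = reindex_mat k A (pick \<alpha>)"
    using A c s by (simp add: submatrix_def reindex_mat_def)
  have "\<alpha> \<subseteq> pick \<alpha> ` {0..<k}"
  proof
    fix i assume i: "i \<in> \<alpha>"
    have "{a \<in> \<alpha>. a < i} \<subset> \<alpha>" using i by auto
    then have "card {a \<in> \<alpha>. a < i} < k" using fin c psubset_card_mono by blast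
    then show "i \<in> pick \<alpha> ` {0..<k}"
      by (intro image_eqI[where x = "card {a \<in> \<alpha>. a < i}"]) (simp_all add: pick_card_in_set[OF i])
  qed
  moreover have "card (pick \<alpha> ` {0..<k}) \<le> k" using card_image_le[of "{0..<k}"] by simp
  ultimately show im: "pick \<alpha> ` {0..<k} = \<alpha>"
    using c card_seteq[of "pick \<alpha> ` {0..<k}" \<alpha>] by auto
  show "inj_on (pick \<alpha>) {0..<k}"
    by (rule eq_card_imp_inj_on) (use im c in auto)
qed

lemma spectrally_monomorphic_iff_reindex:
  assumes A: "A \<in> carrier_mat n n"
  shows "spectrally_monomorphic n k A \<longleftrightarrow>
    (\<forall>f g. inj_on f {0..<k} \<longrightarrow> f ` {0..<k} \<subseteq> {0..<n} \<longrightarrow> inj_on g {0..<k} \<longrightarrow> g ` {0..<k} \<subseteq> {0..<n} \<longrightarrow>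
      char_poly (reindex_mat k A f) = char_poly (reindex_mat k A g))" (is "?L \<longleftrightarrow> ?R")
proof
  assume L: ?L
  show ?R
  proof (intro allI impI)
    fix f g assume fg: "inj_on f {0..<k}" "f ` {0..<k} \<subseteq> {0..<n}" "inj_on g {0..<k}" "g ` {0..<k} \<subseteq> {0..<n}"
    have cf: "card (f ` {0..<k}) = k" and cg: "card (g ` {0..<k}) = k"
      using fg by (auto simp: card_image)
    obtain f' where f': "inj_on f' {0..<k}" "f' ` {0..<k} = f ` {0..<k}"
      "submatrix A (f ` {0..<k}) (f ` {0..<k}) = reindex_mat k A f'"
      using submatrix_eq_reindex[OF A fg(2) cf] by blast
    obtain g' where g': "inj_on g' {0..<k}" "g' ` {0..<k} = g ` {0..<k}"
      "submatrix A (g ` {0..<k}) (g ` {0..<k}) = reindex_mat k A g'"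
      using submatrix_eq_reindex[OF A fg(4) cg] by blast
    have "char_poly (reindex_mat k A f') = char_poly (reindex_mat k A g')"
      using L fg cf cg f'(3) g'(3) unfolding spectrally_monomorphic_def by metis
    then show "char_poly (reindex_mat k A f) = char_poly (reindex_mat k A g)"
      using char_poly_reindex_same_image[OF f'(1) fg(1) f'(2)]
        char_poly_reindex_same_image[OF g'(1) fg(3) g'(2)] by metis
  qed
next
  assume R: ?R
  show ?L
    unfolding spectrally_monomorphic_def
  proof (intro allI impI)
    fix \<alpha> \<beta> assume "\<alpha> \<subseteq> {0..<n}" "card \<alpha> = k" "\<beta> \<subseteq> {0..<n}" "card \<beta> = k"
    then show "char_poly (submatrix A \<alpha> \<alpha>) = char_poly (submatrix A \<beta> \<beta>)"
      using R submatrix_eq_reindex[OF A, of \<alpha> k] submatrix_eq_reindex[OF A, of \<beta> k] by metis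
  qed
qed

section \<open>Gamma equivalence through monomial matrices\<close>

lemma mat_adjoint_index:
  fixes A :: "complex mat"
  assumes "A \<in> carrier_mat m n" "i < n" "j < m"
  shows "mat_adjoint A $$ (i,j) = cnj (A $$ (j,i))"
  using assms by (auto simp: mat_adjoint_def mat_of_rows_def cols_def col_def)

lemma mat_adjoint_carrier:
  fixes A :: "complex mat"
  assumes "A \<in> carrier_mat m n"
  shows "mat_adjoint A \<in> carrier_mat n m"
  using assms by (auto simp: mat_adjoint_def)

lemma hermitian_mat_iff:
  "hermitian_mat n H \<longleftrightarrow> H \<in> carrier_mat n n \<and> (\<forall>i<n. \<forall>j<n. H $$ (j,i) = cnj (H $$ (i,j)))"
proof -
  have "mat_adjoint H = H \<longleftrightarrow> (\<forall>i<n. \<forall>j<n. H $$ (j,i) = cnj (H $$ (i,j)))" if H: "H \<in> carrier_mat n n"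
  proof
    assume "mat_adjoint H = H"
    then show "\<forall>i<n. \<forall>j<n. H $$ (j,i) = cnj (H $$ (i,j))"
      using mat_adjoint_index[OF H] by metis
  next
    assume *: "\<forall>i<n. \<forall>j<n. H $$ (j,i) = cnj (H $$ (i,j))"
    show "mat_adjoint H = H"
    proof (rule eq_matI)
      fix i j assume "i < dim_row H" "j < dim_col H"
      then show "mat_adjoint H $$ (i,j) = H $$ (i,j)"
        using H mat_adjoint_index[OF H, of i j] *[rule_format, of j i] by simp
    qed (use H mat_adjoint_carrier[OF H] in auto)
  qed
  then show ?thesis by (auto simp: hermitian_mat_def)
qed

text \<open>Conjugation by \<open>monomial_mat n p d\<close> moves the entry at \<open>(p i, p j)\<close> to \<open>(i, j)\<close> and multiplies
it by \<open>d i * cnj (d j)\<close>.\<close>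

definition monomial_mat :: "nat \<Rightarrow> (nat \<Rightarrow> nat) \<Rightarrow> (nat \<Rightarrow> complex) \<Rightarrow> complex mat" where
  "monomial_mat n p d = mat n n (\<lambda>(i,j). if j = p i then d i else 0)"

lemma monomial_mat_carrier [simp]: "monomial_mat n p d \<in> carrier_mat n n"
  by (simp add: monomial_mat_def)

lemma monomial_mat_dim [simp]: "dim_row (monomial_mat n p d) = n" "dim_col (monomial_mat n p d) = n"
  by (simp_all add: monomial_mat_def)

lemma monomial_mat_index [simp]:
  "i < n \<Longrightarrow> j < n \<Longrightarrow> monomial_mat n p d $$ (i,j) = (if j = p i then d i else 0)"
  by (simp add: monomial_mat_def)

lemma monomial_mult_index:
  assumes p: "p permutes {0..<n}" and B: "B \<in> carrier_mat n m" and i: "i < n" "j < m"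
  shows "(monomial_mat n p d * B) $$ (i,j) = d i * B $$ (p i, j)"
proof -
  have pi: "p i < n" using permutes_in_image[OF p, of i] i by simp
  have "(monomial_mat n p d * B) $$ (i,j) = (\<Sum>l = 0..<n. (if l = p i then d i else 0) * B $$ (l,j))"
    using i B by (auto simp: monomial_mat_def scalar_prod_def intro!: sum.cong)
  also have "\<dots> = (\<Sum>l = 0..<n. if l = p i then d i * B $$ (l,j) else 0)"
    by (rule sum.cong) auto
  finally show ?thesis using pi by simp
qed

lemma monomial_mult_monomial:
  assumes p: "p permutes {0..<n}"
  shows "monomial_mat n p d * monomial_mat n q e = monomial_mat n (q \<circ> p) (\<lambda>i. d i * e (p i))"
proof -
  have "p i < n" if "i < n" for i using permutes_in_image[OF p, of i] that by simp
  then show ?thesis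
    by (intro eq_matI)
      (simp_all add: monomial_mult_index[OF p monomial_mat_carrier] del: index_mult_mat(1))
qed

lemma monomial_conj_index:
  assumes p: "p permutes {0..<n}" and H: "H \<in> carrier_mat n n" and ij: "i < n" "j < n"
  shows "(monomial_mat n p d * H * mat_adjoint (monomial_mat n p d)) $$ (i,j)
    = d i * cnj (d j) * H $$ (p i, p j)"
proof -
  let ?M = "monomial_mat n p d"
  have pj: "p j < n" using permutes_in_image[OF p, of j] ij by simp
  have MA: "mat_adjoint ?M \<in> carrier_mat n n" by (rule mat_adjoint_carrier) simp
  have "(?M * H * mat_adjoint ?M) $$ (i,j) = (\<Sum>l = 0..<n. (?M * H) $$ (i,l) * mat_adjoint ?M $$ (l,j))"
    using ij H MA by (auto simp: scalar_prod_def)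
  also have "\<dots> = (\<Sum>l = 0..<n. if l = p j then d i * H $$ (p i, l) * cnj (d j) else 0)"
    using ij by (intro sum.cong)
      (auto simp: monomial_mult_index[OF p H] mat_adjoint_index[of _ n n] simp del: index_mult_mat(1))
  finally show ?thesis using pj by simp
qed

definition monomial_unitaries :: "nat \<Rightarrow> complex mat set" where
  "monomial_unitaries n = {monomial_mat n p d | p d. p permutes {0..<n} \<and> (\<forall>i<n. cmod (d i) = 1)}"

lemma monomial_unitaries_mult:
  assumes "A \<in> monomial_unitaries n" "B \<in> monomial_unitaries n"
  shows "A * B \<in> monomial_unitaries n"
proof -
  obtain p d q e where *: "A = monomial_mat n p d" "p permutes {0..<n}" "\<forall>i<n. cmod (d i) = 1"
    "B = monomial_mat n q e" "q permutes {0..<n}" "\<forall>i<n. cmod (e i) = 1"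
    using assms unfolding monomial_unitaries_def by blast
  have "p i < n" if "i < n" for i using permutes_in_image[OF *(2), of i] that by simp
  then have "\<forall>i<n. cmod (d i * e (p i)) = 1" using * by (simp add: norm_mult)
  then show ?thesis
    unfolding monomial_unitaries_def *(1) *(4) monomial_mult_monomial[OF *(2)]
    using permutes_compose[OF *(2) *(5)] by blast
qed

text \<open>The generated group is closed under inversion in the unit group of the matrix ring. Exhibiting a two-sided
inverse in the same set serves twice: it shows that monomial matrices are units, and it identifies
the abstract inverse.\<close>

lemma monomial_unitaries_inverse:
  assumes "A \<in> monomial_unitaries n"
  obtains B where "B \<in> monomial_unitaries n" "A * B = 1\<^sub>m n" "B * A = 1\<^sub>m n"
proof -
  obtain p d where *: "A = monomial_mat n p d" "p permutes {0..<n}" "\<forall>i<n. cmod (d i) = 1"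
    using assms unfolding monomial_unitaries_def by blast
  let ?q = "Hilbert_Choice.inv p"
  have q: "?q permutes {0..<n}" by (rule permutes_inv[OF *(2)])
  have qn: "?q i < n" if "i < n" for i using permutes_in_image[OF q, of i] that by simp
  have pn: "p i < n" if "i < n" for i using permutes_in_image[OF *(2), of i] that by simp
  have id: "monomial_mat n id e = 1\<^sub>m n" if "\<forall>i<n. e i = 1" for e
    using that by (intro eq_matI) (auto simp: monomial_mat_def)
  define B where "B = monomial_mat n ?q (\<lambda>i. cnj (d (?q i)))"
  have u: "z * cnj z = 1" "cnj z * z = 1" if "cmod z = 1" for z
    using that by (simp_all add: complex_norm_square[symmetric] mult.commute)
  have "B \<in> monomial_unitaries n"
    using q qn *(3) unfolding monomial_unitaries_def B_def
    by (auto intro!: exI[of _ ?q] exI[of _ "\<lambda>i. cnj (d (?q i))"])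
  moreover have "A * B = 1\<^sub>m n"
    unfolding *(1) B_def monomial_mult_monomial[OF *(2)] permutes_inv_o(2)[OF *(2)]
    using *(3) u permutes_inverses(2)[OF *(2)] by (intro id) auto
  moreover have "B * A = 1\<^sub>m n"
    unfolding *(1) B_def monomial_mult_monomial[OF q] permutes_inv_o(1)[OF *(2)]
    using *(3) u qn by (intro id) auto
  ultimately show thesis by (rule that)
qed

lemma Gamma_group_eq_monomial: "Gamma_group n = monomial_unitaries n"
proof
  let ?R = "ring_mat TYPE(complex) n ()"
  interpret R: ring ?R by (rule ring_mat)
  interpret U: group "units_of ?R" by (rule R.units_group)
  have mult: "x \<otimes>\<^bsub>GL_mat n\<^esub> y = x * y" and one: "\<one>\<^bsub>GL_mat n\<^esub> = 1\<^sub>m n" for x y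
    by (simp_all add: GL_mat_def units_of_def ring_mat_def)
  have mono_GL: "A \<in> carrier (units_of ?R)" if A: "A \<in> monomial_unitaries n" for A
  proof -
    obtain B where B: "B \<in> monomial_unitaries n" "A * B = 1\<^sub>m n" "B * A = 1\<^sub>m n"
      using monomial_unitaries_inverse[OF A] by blast
    have "A \<in> carrier_mat n n" "B \<in> carrier_mat n n"
      using A B(1) by (auto simp: monomial_unitaries_def)
    then show ?thesis using B by (auto simp: units_of_def Units_def ring_mat_def)
  qed
  have diag: "D = monomial_mat n id (\<lambda>i. D $$ (i,i))"
    if "D \<in> unitary_diagonal_mats n" for D
    using that by (intro eq_matI)
      (auto simp: unitary_diagonal_mats_def diagonal_mat_def monomial_mat_def)
  have perm: "\<exists>q. q permutes {0..<n} \<and> P = monomial_mat n q (\<lambda>i. 1)"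
    if P: "P \<in> permutation_mats n" for P
  proof -
    obtain p where p: "p permutes {0..<n}" "P = mat n n (\<lambda>(i,j). if i = p j then 1 else 0)"
      using P by (auto simp: permutation_mats_def)
    have "P = monomial_mat n (Hilbert_Choice.inv p) (\<lambda>i. 1)"
      unfolding p(2) monomial_mat_def
      by (rule cong_mat) (auto simp: permutes_inverses[OF p(1)])
    then show ?thesis using permutes_inv[OF p(1)] by blast
  qed
  have gen: "A \<in> monomial_unitaries n" if "A \<in> unitary_diagonal_mats n \<union> permutation_mats n" for A
    using that
  proof
    assume A: "A \<in> unitary_diagonal_mats n"
    then have "\<forall>i<n. cmod (A $$ (i,i)) = 1" by (simp add: unitary_diagonal_mats_def)
    then have "monomial_mat n id (\<lambda>i. A $$ (i,i)) \<in> monomial_unitaries n"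
      unfolding monomial_unitaries_def using permutes_id by blast
    then show ?thesis by (subst diag[OF A])
  next
    assume "A \<in> permutation_mats n"
    then obtain q where q: "q permutes {0..<n}" "A = monomial_mat n q (\<lambda>i. 1)"
      using perm by blast
    show ?thesis
      unfolding monomial_unitaries_def q(2)
      by (intro CollectI exI[of _ q] exI[of _ "\<lambda>i. 1"]) (simp add: q(1))
  qed
  show "Gamma_group n \<subseteq> monomial_unitaries n"
  proof
    fix S assume "S \<in> Gamma_group n"
    then have "S \<in> generate (GL_mat n) (unitary_diagonal_mats n \<union> permutation_mats n)"
      by (simp add: Gamma_group_def)
    then show "S \<in> monomial_unitaries n"
    proof (induction rule: generate.induct)
      case one
      have "1\<^sub>m n = monomial_mat n id (\<lambda>i. 1)" by (intro eq_matI) (auto simp: monomial_mat_def)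
      then show ?case unfolding \<open>\<one>\<^bsub>GL_mat n\<^esub> = 1\<^sub>m n\<close> monomial_unitaries_def
        using permutes_id by fastforce
    next
      case (incl h) then show ?case by (rule gen)
    next
      case (inv h)
      have h: "h \<in> monomial_unitaries n" using inv by (rule gen)
      obtain B where B: "B \<in> monomial_unitaries n" "h * B = 1\<^sub>m n" "B * h = 1\<^sub>m n"
        using monomial_unitaries_inverse[OF h] by blast
      have "inv\<^bsub>GL_mat n\<^esub> h = B"
        using U.inv_equality[of B h] B mono_GL[OF h] mono_GL[OF B(1)] mult one
        by (simp add: GL_mat_def)
      then show ?case using B by simp
    next
      case (eng h1 h2) then show ?case by (simp add: mult monomial_unitaries_mult)
    qed
  qed
  show "monomial_unitaries n \<subseteq> Gamma_group n"
  proof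
    fix S assume "S \<in> monomial_unitaries n"
    then obtain p d where *: "S = monomial_mat n p d" "p permutes {0..<n}" "\<forall>i<n. cmod (d i) = 1"
      unfolding monomial_unitaries_def by blast
    have S: "S = monomial_mat n id d * monomial_mat n p (\<lambda>i. 1)"
      unfolding *(1) by (subst monomial_mult_monomial) (auto simp: permutes_id)
    have "monomial_mat n id d \<in> unitary_diagonal_mats n"
      using *(3) by (auto simp: unitary_diagonal_mats_def diagonal_mat_def monomial_mat_def)
    moreover have "monomial_mat n p (\<lambda>i. 1) \<in> permutation_mats n"
      unfolding permutation_mats_def
    proof (intro CollectI exI conjI)
      show "Hilbert_Choice.inv p permutes {0..<n}" by (rule permutes_inv[OF *(2)])
      show "monomial_mat n p (\<lambda>i. 1) = mat n n (\<lambda>(i,j). if i = Hilbert_Choice.inv p j then 1 else 0)"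
        unfolding monomial_mat_def
        by (rule cong_mat) (auto simp: permutes_inv_eq[OF *(2)] permutes_inverses[OF *(2)])
    qed
    ultimately show "S \<in> Gamma_group n"
      unfolding S Gamma_group_def mult[symmetric]
      by (intro generate.eng generate.incl) auto
  qed
qed

text \<open>All later arguments use Gamma equivalence only in this form, where it is a statement on entries.\<close>

lemma Gamma_equivalent_iff:
  assumes H: "hermitian_mat n H" and K: "hermitian_mat n K"
  shows "Gamma_equivalent n H K \<longleftrightarrow>
    (\<exists>(a::real) (b::real) p d. a \<noteq> 0 \<and> p permutes {0..<n} \<and> (\<forall>i<n. cmod (d i) = 1) \<and>
      (\<forall>i<n. \<forall>j<n. K $$ (i,j) =
         complex_of_real a * (d i * cnj (d j) * H $$ (p i, p j)) + (if i = j then complex_of_real b else 0)))"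
proof -
  have H': "H \<in> carrier_mat n n" and K': "K \<in> carrier_mat n n"
    using H K by (auto simp: hermitian_mat_def)
  have "K = complex_of_real a \<cdot>\<^sub>m (monomial_mat n p d * H * mat_adjoint (monomial_mat n p d))
           + complex_of_real b \<cdot>\<^sub>m 1\<^sub>m n \<longleftrightarrow>
      (\<forall>i<n. \<forall>j<n. K $$ (i,j) =
         complex_of_real a * (d i * cnj (d j) * H $$ (p i, p j)) + (if i = j then complex_of_real b else 0))"
    (is "K = ?X \<longleftrightarrow> ?E") if p: "p permutes {0..<n}" for a b :: real and p d
  proof -
    have X: "?X $$ (i,j) = complex_of_real a * (d i * cnj (d j) * H $$ (p i, p j))
        + (if i = j then complex_of_real b else 0)" if "i < n" "j < n" for i j
      using that monomial_conj_index[OF p H' that] mat_adjoint_carrier[of "monomial_mat n p d" n n]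
      by (simp del: index_mult_mat(1))
    have "dim_row ?X = n" "dim_col ?X = n" by auto
    then show ?thesis using X K' by (metis carrier_matD eq_matI)
  qed
  then show ?thesis
    using H K unfolding Gamma_equivalent_def Gamma_group_eq_monomial monomial_unitaries_def
    by blast
qed

text \<open>With \<open>D\<close> the diagonal matrix of \<open>d\<close>, the relation says \<open>A = a D B D\<^sup>* + b I\<close>, and the two
determinants of \<open>D\<close> and its adjoint cancel.\<close>

lemma char_poly_monomial_affine:
  fixes A B :: "complex mat"
  assumes A: "A \<in> carrier_mat k k" and B: "B \<in> carrier_mat k k" and a: "a \<noteq> 0"
    and d: "\<And>i. i < k \<Longrightarrow> cmod (d i) = 1"
    and AB: "\<And>i j. i < k \<Longrightarrow> j < k \<Longrightarrow>
      A $$ (i,j) = a * (d i * cnj (d j) * B $$ (i,j)) + (if i = j then b else 0)"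
  shows "poly (char_poly A) x = a ^ k * poly (char_poly B) ((x - b) / a)"
proof -
  let ?D = "monomial_mat k id d"
  let ?N = "mat k k (\<lambda>(i,j). (if i = j then (x - b) / a else 0) - B $$ (i,j))"
  have u: "d i * cnj (d i) = 1" if "i < k" for i
    using d[OF that] by (simp add: complex_norm_square[symmetric])
  have adj: "mat_adjoint ?D \<in> carrier_mat k k" by (rule mat_adjoint_carrier) simp
  have "?D * mat_adjoint ?D = ?D * 1\<^sub>m k * mat_adjoint ?D" using adj by simp
  also have "\<dots> = 1\<^sub>m k"
  proof (rule eq_matI)
    fix i j assume "i < dim_row (1\<^sub>m k :: complex mat)" "j < dim_col (1\<^sub>m k :: complex mat)"
    then show "(?D * 1\<^sub>m k * mat_adjoint ?D) $$ (i,j) = 1\<^sub>m k $$ (i,j)"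
      using monomial_conj_index[OF permutes_id one_carrier_mat, of i k j d] u by simp
  qed (use adj in auto)
  finally have "det ?D * det (mat_adjoint ?D) = 1"
    using det_mult[of ?D k "mat_adjoint ?D"] adj by simp
  moreover have "mat k k (\<lambda>(i,j). (if i = j then x else 0) - A $$ (i,j))
      = a \<cdot>\<^sub>m (?D * ?N * mat_adjoint ?D)"
    using a adj u by (intro eq_matI) (auto simp: monomial_conj_index[OF permutes_id] AB field_simps simp del: index_mult_mat(1))
  moreover have "det (?D * ?N * mat_adjoint ?D) = det ?D * det ?N * det (mat_adjoint ?D)"
    using det_mult[of "?D * ?N" k "mat_adjoint ?D"] det_mult[of ?D k ?N]
      mult_carrier_mat[of ?D k k ?N k] adj by simp
  ultimately have "poly (char_poly A) x = a ^ k * det ?N"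
    unfolding poly_char_poly_eq_det[OF A] using adj by simp
  then show ?thesis by (simp add: poly_char_poly_eq_det[OF B])
qed

text \<open>A reindexing of \<open>K\<close> by \<open>f\<close> is, up to a diagonal unitary and an affine change, the reindexing of
\<open>H\<close> by \<open>p \<circ> f\<close>; as \<open>p\<close> is a permutation, \<open>p \<circ> f\<close> ranges over all injections when \<open>f\<close>
does.\<close>

lemma Gamma_equivalent_spectrally_monomorphic:
  assumes "Gamma_equivalent n H K"
  shows "spectrally_monomorphic n k H \<longleftrightarrow> spectrally_monomorphic n k K"
proof -
  have HK: "hermitian_mat n H" "hermitian_mat n K" using assms by (auto simp: Gamma_equivalent_def)
  then have H: "H \<in> carrier_mat n n" and K: "K \<in> carrier_mat n n" by (auto simp: hermitian_mat_def)
  obtain a b :: real and p d where a: "a \<noteq> 0" and p: "p permutes {0..<n}"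
    and d: "\<forall>i<n. cmod (d i) = 1"
    and E: "\<And>i j. i < n \<Longrightarrow> j < n \<Longrightarrow> K $$ (i,j) =
         complex_of_real a * (d i * cnj (d j) * H $$ (p i, p j)) + (if i = j then complex_of_real b else 0)"
    using assms unfolding Gamma_equivalent_iff[OF HK] by metis
  let ?q = "Hilbert_Choice.inv p"
  have q: "?q permutes {0..<n}" by (rule permutes_inv[OF p])
  have key: "poly (char_poly (reindex_mat k K f)) x = complex_of_real a ^ k *
      poly (char_poly (reindex_mat k H (p \<circ> f))) ((x - complex_of_real b) / complex_of_real a)"
    if f: "inj_on f {0..<k}" "f ` {0..<k} \<subseteq> {0..<n}" for f x
  proof (rule char_poly_monomial_affine[where d = "d \<circ> f"])
    fix i j assume ij: "i < k" "j < k"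
    have "f i < n" "f j < n" using f(2) ij by (auto simp: image_subset_iff)
    moreover have "f i = f j \<longleftrightarrow> i = j" using inj_on_eq_iff[OF f(1)] ij by simp
    ultimately show "reindex_mat k K f $$ (i,j) = a * ((d \<circ> f) i * cnj ((d \<circ> f) j) *
        reindex_mat k H (p \<circ> f) $$ (i,j)) + (if i = j then complex_of_real b else 0)"
      using ij E by simp
  qed (use a d f in \<open>auto simp: image_subset_iff\<close>)
  have comp: "inj_on (r \<circ> f) {0..<k}" "(r \<circ> f) ` {0..<k} \<subseteq> {0..<n}"
    if "r permutes {0..<n}" "inj_on f {0..<k}" "f ` {0..<k} \<subseteq> {0..<n}" for r f
  proof -
    show "inj_on (r \<circ> f) {0..<k}"
      using comp_inj_on[OF that(2)] permutes_inj_on[OF that(1)] by blast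
    show "(r \<circ> f) ` {0..<k} \<subseteq> {0..<n}"
      using that(3) permutes_image[OF that(1)] unfolding image_comp[symmetric] by blast
  qed
  show ?thesis
    unfolding spectrally_monomorphic_iff_reindex[OF H] spectrally_monomorphic_iff_reindex[OF K]
  proof (intro iffI allI impI)
    fix f g
    assume f: "inj_on f {0..<k}" "f ` {0..<k} \<subseteq> {0..<n}" and g: "inj_on g {0..<k}" "g ` {0..<k} \<subseteq> {0..<n}"
    { assume *: "\<forall>f g. inj_on f {0..<k} \<longrightarrow> f ` {0..<k} \<subseteq> {0..<n} \<longrightarrow> inj_on g {0..<k} \<longrightarrow>
        g ` {0..<k} \<subseteq> {0..<n} \<longrightarrow> char_poly (reindex_mat k H f) = char_poly (reindex_mat k H g)"
      have "char_poly (reindex_mat k H (p \<circ> f)) = char_poly (reindex_mat k H (p \<circ> g))"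
        using * comp[OF p f] comp[OF p g] by blast
      then show "char_poly (reindex_mat k K f) = char_poly (reindex_mat k K g)"
        by (intro poly_ext) (simp add: key[OF f] key[OF g]) }
    { assume *: "\<forall>f g. inj_on f {0..<k} \<longrightarrow> f ` {0..<k} \<subseteq> {0..<n} \<longrightarrow> inj_on g {0..<k} \<longrightarrow>
        g ` {0..<k} \<subseteq> {0..<n} \<longrightarrow> char_poly (reindex_mat k K f) = char_poly (reindex_mat k K g)"
      have cp: "char_poly (reindex_mat k K (?q \<circ> f)) = char_poly (reindex_mat k K (?q \<circ> g))"
        using * comp[OF q f] comp[OF q g] by blast
      have pq: "p \<circ> (?q \<circ> h) = h" for h :: "nat \<Rightarrow> nat"
        using permutes_inverses(1)[OF p] by auto
      have "poly (char_poly (reindex_mat k H f)) y = poly (char_poly (reindex_mat k H g)) y" for y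
        using key[OF comp[OF q f], of "a * y + b"] key[OF comp[OF q g], of "a * y + b"] cp a
        by (simp add: pq)
      then show "char_poly (reindex_mat k H f) = char_poly (reindex_mat k H g)"
        by (intro poly_ext) simp }
  qed
qed

section \<open>Monomorphy of the matrices \<open>Hn n c\<close>\<close>

lemma Hn_hermitian: "hermitian_mat n (Hn n c)"
  by (auto simp: hermitian_mat_iff Hn_def)

text \<open>The enumeration \<open>pick \<alpha>\<close> is increasing, so it preserves the positions above the diagonal.\<close>

lemma Hn_spectrally_monomorphic: "spectrally_monomorphic n k (Hn n c)"
proof -
  have "submatrix (Hn n c) \<alpha> \<alpha> = Hn k c" if a: "\<alpha> \<subseteq> {0..<n}" "card \<alpha> = k" for \<alpha>
  proof -
    have s: "{i. i < n \<and> i \<in> \<alpha>} = \<alpha>" using a by auto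
    have mono: "pick \<alpha> i < pick \<alpha> j" if "i < j" "j < k" for i j
      by (rule pick_mono_le) (use that a in auto)
    have lt: "pick \<alpha> i < n" if "i < k" for i
      using pick_le[of i n \<alpha>] that a s by simp
    have "pick \<alpha> i < pick \<alpha> j \<longleftrightarrow> i < j" "pick \<alpha> i = pick \<alpha> j \<longleftrightarrow> i = j" if "i < k" "j < k" for i j
      using mono[of i j] mono[of j i] that by (cases i j rule: linorder_cases; auto)+
    then show ?thesis
      using a s lt by (intro eq_matI) (auto simp: submatrix_def Hn_def)
  qed
  then show ?thesis by (simp add: spectrally_monomorphic_def)
qed

section \<open>Traces of powers as sums over closed walks\<close>

definition mat_trace :: "'a :: comm_monoid_add mat \<Rightarrow> 'a" where
  "mat_trace A = (\<Sum>i = 0..<dim_row A. A $$ (i,i))"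

lemma mat_trace_mult_commute:
  fixes A B :: "'a :: comm_semiring_0 mat"
  assumes A: "A \<in> carrier_mat n m" and B: "B \<in> carrier_mat m n"
  shows "mat_trace (A * B) = mat_trace (B * A)"
proof -
  have "mat_trace (A * B) = (\<Sum>i = 0..<n. \<Sum>j = 0..<m. A $$ (i,j) * B $$ (j,i))"
    using A B by (auto simp: mat_trace_def scalar_prod_def)
  also have "\<dots> = (\<Sum>j = 0..<m. \<Sum>i = 0..<n. B $$ (j,i) * A $$ (i,j))"
    by (subst sum.swap) (simp add: mult.commute)
  also have "\<dots> = mat_trace (B * A)"
    using A B by (auto simp: mat_trace_def scalar_prod_def)
  finally show ?thesis .
qed

lemma upper_triangular_pow:
  fixes A :: "'a :: comm_semiring_1 mat"
  assumes A: "A \<in> carrier_mat n n" and ut: "\<And>i j. j < i \<Longrightarrow> i < n \<Longrightarrow> A $$ (i,j) = 0"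
  shows "(\<forall>i<n. \<forall>j<i. (A ^\<^sub>m m) $$ (i,j) = 0) \<and> (\<forall>i<n. (A ^\<^sub>m m) $$ (i,i) = (A $$ (i,i)) ^ m)"
proof (induction m)
  case 0
  then show ?case using A by auto
next
  case (Suc m)
  have Am: "A ^\<^sub>m m \<in> carrier_mat n n" using A by simp
  have eq: "(A ^\<^sub>m Suc m) $$ (i,j) = (\<Sum>l = 0..<n. (A ^\<^sub>m m) $$ (i,l) * A $$ (l,j))"
    if "i < n" "j < n" for i j
    using A Am that by (auto simp: scalar_prod_def)
  have "(A ^\<^sub>m Suc m) $$ (i,j) = 0" if "i < n" "j < i" for i j
    unfolding eq[OF that(1) less_trans[OF that(2,1)]]
  proof (rule sum.neutral, intro ballI)
    fix l assume "l \<in> {0..<n}"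
    then show "(A ^\<^sub>m m) $$ (i,l) * A $$ (l,j) = 0"
      using Suc ut that by (cases "l < i") auto
  qed
  moreover have "(A ^\<^sub>m Suc m) $$ (i,i) = (A $$ (i,i)) ^ Suc m" if "i < n" for i
  proof -
    have "(A ^\<^sub>m Suc m) $$ (i,i) = (\<Sum>l = 0..<n. if l = i then (A ^\<^sub>m m) $$ (i,i) * A $$ (i,i) else 0)"
      unfolding eq[OF that that]
    proof (rule sum.cong[OF refl])
      fix l assume "l \<in> {0..<n}"
      then show "(A ^\<^sub>m m) $$ (i,l) * A $$ (l,i) = (if l = i then (A ^\<^sub>m m) $$ (i,i) * A $$ (i,i) else 0)"
        using Suc ut that by (cases l i rule: linorder_cases) auto
    qed
    then show ?thesis using that Suc by (simp add: mult.commute)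
  qed
  ultimately show ?case by blast
qed

text \<open>The Schur form of \<open>A\<close> can be taken with any prescribed list \<open>es\<close> of the roots of the
characteristic polynomial on its diagonal. So matrices with equal characteristic polynomials share
the power sums.\<close>

lemma mat_trace_pow_eigenvalues:
  fixes A :: "complex mat"
  assumes A: "A \<in> carrier_mat n n" and c: "char_poly A = (\<Prod>e \<leftarrow> es. [:- e, 1:])"
  shows "mat_trace (A ^\<^sub>m m) = (\<Sum>e \<leftarrow> es. e ^ m)"
proof -
  obtain B P Q where "schur_decomposition A es = (B,P,Q)" by (cases "schur_decomposition A es") auto
  from schur_decomposition[OF A c this] have sim: "similar_mat_wit A B P Q"
    and ut: "upper_triangular B" and d: "diag_mat B = es" by auto
  have carr: "B \<in> carrier_mat n n" "P \<in> carrier_mat n n" "Q \<in> carrier_mat n n" and QP: "Q * P = 1\<^sub>m n"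
    using similar_mat_witD2[OF A sim] by auto
  have Bm: "B ^\<^sub>m m \<in> carrier_mat n n" using carr by simp
  have "mat_trace (A ^\<^sub>m m) = mat_trace (P * B ^\<^sub>m m * Q)"
    using similar_mat_wit_pow_id[OF sim] by simp
  also have "\<dots> = mat_trace (Q * (P * B ^\<^sub>m m))"
    by (rule mat_trace_mult_commute[of _ n n]) (use carr Bm in auto)
  also have "Q * (P * B ^\<^sub>m m) = B ^\<^sub>m m"
    using assoc_mult_mat[of Q n n P n "B ^\<^sub>m m" n] carr Bm QP by simp
  also have "mat_trace (B ^\<^sub>m m) = (\<Sum>i = 0..<n. (B $$ (i,i)) ^ m)"
    unfolding mat_trace_def using carr upper_triangular_pow[OF carr(1), of m] upper_triangularD[OF ut]
    by auto
  also have "\<dots> = (\<Sum>e \<leftarrow> diag_mat B. e ^ m)"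
    using carr by (simp add: diag_mat_def interv_sum_list_conv_sum_set_nat comp_def)
  finally show ?thesis using d by simp
qed

lemma mat_trace_pow_char_poly:
  fixes A B :: "complex mat"
  assumes "A \<in> carrier_mat n n" "B \<in> carrier_mat n n" "char_poly A = char_poly B"
  shows "mat_trace (A ^\<^sub>m m) = mat_trace (B ^\<^sub>m m)"
  using char_poly_factorized[OF assms(1)] mat_trace_pow_eigenvalues[OF assms(1)]
    mat_trace_pow_eigenvalues[OF assms(2)] assms(3) by metis

abbreviation words :: "'a set \<Rightarrow> nat \<Rightarrow> 'a list set" where
  "words X m \<equiv> {w. set w \<subseteq> X \<and> length w = m}"

lemma sum_words_Suc:
  assumes "finite X"
  shows "(\<Sum>w \<in> words X (Suc m). g w) = (\<Sum>x\<in>X. \<Sum>w \<in> words X m. g (x # w))"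
proof -
  have "(\<Sum>w \<in> words X (Suc m). g w) = (\<Sum>(w,x) \<in> words X m \<times> X. g (x # w))"
    unfolding lists_length_Suc_eq
    by (subst sum.reindex) (auto simp: inj_on_def split_def)
  also have "\<dots> = (\<Sum>x\<in>X. \<Sum>w \<in> words X m. g (x # w))"
    by (subst sum.cartesian_product[symmetric], subst sum.swap) simp
  finally show ?thesis .
qed

fun walk_weight :: "('a \<Rightarrow> 'a \<Rightarrow> 'b :: comm_semiring_1) \<Rightarrow> 'a \<Rightarrow> 'a list \<Rightarrow> 'a \<Rightarrow> 'b" where
  "walk_weight h a [] b = h a b"
| "walk_weight h a (x # w) b = h a x * walk_weight h x w b"

text \<open>The weight of the closed walk that visits the listed vertices and returns to the first one.\<close>

fun cycle_weight :: "('a \<Rightarrow> 'a \<Rightarrow> 'b :: comm_semiring_1) \<Rightarrow> 'a list \<Rightarrow> 'b" where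
  "cycle_weight h [] = 0"
| "cycle_weight h (a # w) = walk_weight h a w a"

lemma pow_mat_index_walks:
  fixes A :: "'a :: comm_semiring_1 mat"
  assumes A: "A \<in> carrier_mat k k" and "a < k" "b < k"
  shows "(A ^\<^sub>m Suc m) $$ (a,b) = (\<Sum>w \<in> words {0..<k} m. walk_weight (\<lambda>i j. A $$ (i,j)) a w b)"
  using assms(2,3)
proof (induction m arbitrary: a)
  case 0
  have "words {0..<k} 0 = {[]}" by auto
  then show ?case using A 0 by simp
next
  case (Suc m)
  have comm: "A ^\<^sub>m Suc l = A * A ^\<^sub>m l" for l
  proof (induction l)
    case 0 then show ?case using A by simp
  next
    case (Suc l)
    have "A ^\<^sub>m Suc (Suc l) = A * A ^\<^sub>m l * A" using Suc by simp
    also have "\<dots> = A * (A ^\<^sub>m l * A)" using A by (intro assoc_mult_mat) auto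
    finally show ?case by simp
  qed
  have Am: "A ^\<^sub>m Suc m \<in> carrier_mat k k" using A by (intro pow_carrier_mat)
  have "(A ^\<^sub>m Suc (Suc m)) $$ (a,b) = (\<Sum>l = 0..<k. A $$ (a,l) * (A ^\<^sub>m Suc m) $$ (l,b))"
    unfolding comm[of "Suc m"] using A Am Suc.prems by (auto simp: scalar_prod_def simp del: pow_mat.simps)
  also have "\<dots> = (\<Sum>l = 0..<k. \<Sum>w \<in> words {0..<k} m. A $$ (a,l) * walk_weight (\<lambda>i j. A $$ (i,j)) l w b)"
    using Suc by (intro sum.cong) (auto simp: sum_distrib_left simp del: pow_mat.simps)
  finally show ?case by (simp add: sum_words_Suc)
qed

lemma walk_weight_map: "walk_weight h (f a) (map f w) (f b) = walk_weight (\<lambda>i j. h (f i) (f j)) a w b"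
  by (induction w arbitrary: a) auto

lemma cycle_weight_map: "cycle_weight h (map f w) = cycle_weight (\<lambda>i j. h (f i) (f j)) w"
  by (cases w) (auto simp: walk_weight_map)

lemma walk_weight_cong:
  "(\<And>i j. i \<in> insert a (insert b (set w)) \<Longrightarrow> j \<in> insert a (insert b (set w)) \<Longrightarrow> h i j = h' i j) \<Longrightarrow>
   walk_weight h a w b = walk_weight h' a w b"
proof (induction w arbitrary: a)
  case Nil
  then show ?case by simp
next
  case (Cons x w)
  have "walk_weight h x w b = walk_weight h' x w b"
    by (rule Cons.IH) (use Cons.prems in auto)
  moreover have "h a x = h' a x" by (rule Cons.prems) auto
  ultimately show ?case by simp
qed

text \<open>The trace depends on the image of \<open>f\<close> only, so it becomes a function of a set of indices that is a
sum over its subsets. This is what makes the counting arguments below applicable.\<close>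

lemma mat_trace_reindex_pow:
  assumes f: "inj_on f {0..<k}"
  shows "mat_trace (reindex_mat k A f ^\<^sub>m Suc m)
    = (\<Sum>w \<in> words (f ` {0..<k}) (Suc m). cycle_weight (\<lambda>i j. A $$ (i,j)) w)"
proof -
  let ?B = "reindex_mat k A f"
  have w: "walk_weight (\<lambda>i j. ?B $$ (i,j)) a w a = cycle_weight (\<lambda>i j. A $$ (i,j)) (map f (a # w))"
    if "a < k" "set w \<subseteq> {0..<k}" for a w
    unfolding cycle_weight_map cycle_weight.simps
    by (rule walk_weight_cong) (use that in \<open>auto simp: subset_iff\<close>)
  have bij: "bij_betw (map f) (words {0..<k} (Suc m)) (words (f ` {0..<k}) (Suc m))"
  proof (rule bij_betw_imageI)
    show "inj_on (map f) (words {0..<k} (Suc m))"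
    proof (rule inj_onI)
      fix v w assume "v \<in> words {0..<k} (Suc m)" "w \<in> words {0..<k} (Suc m)" and e: "map f v = map f w"
      then have "set v \<union> set w \<subseteq> {0..<k}" by auto
      then show "v = w" using map_inj_on[OF e] inj_on_subset[OF f] by blast
    qed
    show "map f ` words {0..<k} (Suc m) = words (f ` {0..<k}) (Suc m)"
    proof
      show "map f ` words {0..<k} (Suc m) \<subseteq> words (f ` {0..<k}) (Suc m)"
        by (auto dest: subsetD intro!: imageI)
      show "words (f ` {0..<k}) (Suc m) \<subseteq> map f ` words {0..<k} (Suc m)"
      proof
        fix w assume w: "w \<in> words (f ` {0..<k}) (Suc m)"
        let ?v = "map (inv_into {0..<k} f) w"
        have "inv_into {0..<k} f x \<in> {0..<k}" "f (inv_into {0..<k} f x) = x" if "x \<in> set w" for x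
          using w that inv_into_into[of x f "{0..<k}"] f_inv_into_f[of x f "{0..<k}"] by blast+
        then have "?v \<in> words {0..<k} (Suc m)" "map f ?v = w"
          using w by (auto simp: map_idI)
        then show "w \<in> map f ` words {0..<k} (Suc m)" by (metis (no_types, lifting) imageI)
      qed
    qed
  qed
  have "mat_trace (?B ^\<^sub>m Suc m) = (\<Sum>a = 0..<k. (?B ^\<^sub>m Suc m) $$ (a,a))"
    by (simp add: mat_trace_def)
  also have "\<dots> = (\<Sum>a = 0..<k. \<Sum>w \<in> words {0..<k} m. walk_weight (\<lambda>i j. ?B $$ (i,j)) a w a)"
    by (intro sum.cong refl) (simp add: pow_mat_index_walks[OF reindex_mat_carrier] del: pow_mat.simps)
  also have "\<dots> = (\<Sum>a = 0..<k. \<Sum>w \<in> words {0..<k} m. cycle_weight (\<lambda>i j. A $$ (i,j)) (map f (a # w)))"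
    by (intro sum.cong refl) (use w in auto)
  also have "\<dots> = (\<Sum>w \<in> words {0..<k} (Suc m). cycle_weight (\<lambda>i j. A $$ (i,j)) (map f w))"
    by (simp only: sum_words_Suc[OF finite_atLeastLessThan])
  also have "\<dots> = (\<Sum>w \<in> words (f ` {0..<k}) (Suc m). cycle_weight (\<lambda>i j. A $$ (i,j)) w)"
    by (rule sum.reindex_bij_betw[OF bij])
  finally show ?thesis .
qed

lemma spectrally_monomorphic_cycle_sums:
  assumes A: "A \<in> carrier_mat n n" and mono: "spectrally_monomorphic n k A"
    and a: "\<alpha> \<subseteq> {0..<n}" "card \<alpha> = k" and b: "\<beta> \<subseteq> {0..<n}" "card \<beta> = k"
  shows "(\<Sum>w \<in> words \<alpha> (Suc m). cycle_weight (\<lambda>i j. A $$ (i,j)) w)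
       = (\<Sum>w \<in> words \<beta> (Suc m). cycle_weight (\<lambda>i j. A $$ (i,j)) w)"
proof -
  obtain f where f: "inj_on f {0..<k}" "f ` {0..<k} = \<alpha>"
    by (rule submatrix_eq_reindex[OF A a])
  obtain g where g: "inj_on g {0..<k}" "g ` {0..<k} = \<beta>"
    by (rule submatrix_eq_reindex[OF A b])
  have "char_poly (reindex_mat k A f) = char_poly (reindex_mat k A g)"
    by (rule mono[unfolded spectrally_monomorphic_iff_reindex[OF A], rule_format, OF f(1) _ g(1)])
      (simp_all add: f(2) g(2) a b)
  then have "mat_trace (reindex_mat k A f ^\<^sub>m Suc m) = mat_trace (reindex_mat k A g ^\<^sub>m Suc m)"
    by (rule mat_trace_pow_char_poly[OF reindex_mat_carrier reindex_mat_carrier])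
  then show ?thesis
    unfolding mat_trace_reindex_pow[OF f(1)] mat_trace_reindex_pow[OF g(1)] f(2) g(2) .
qed

section \<open>Skew conference matrices are monomorphic\<close>

lemma det_dim_2:
  fixes A :: "'a :: comm_ring_1 mat"
  assumes A: "A \<in> carrier_mat 2 2"
  shows "det A = A $$ (0,0) * A $$ (1,1) - A $$ (0,1) * A $$ (1,0)"
proof -
  have "det A = (\<Sum>i<2. A $$ (i,0) * cofactor A i 0)"
    by (rule laplace_expansion_column[OF A]) simp
  also have "\<dots> = A $$ (0,0) * A $$ (1,1) - A $$ (1,0) * A $$ (0,1)"
    using A by (simp add: numeral_2_eq_2 cofactor_def mat_delete_def det_single)
  finally show ?thesis by (simp add: mult.commute)
qed

lemma det_dim_3:
  fixes A :: "'a :: comm_ring_1 mat"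
  assumes A: "A \<in> carrier_mat 3 3"
  shows "det A = A $$ (0,0) * (A $$ (1,1) * A $$ (2,2) - A $$ (1,2) * A $$ (2,1))
    - A $$ (1,0) * (A $$ (0,1) * A $$ (2,2) - A $$ (0,2) * A $$ (2,1))
    + A $$ (2,0) * (A $$ (0,1) * A $$ (1,2) - A $$ (0,2) * A $$ (1,1))"
proof -
  have c: "det (mat_delete A i 0) = mat_delete A i 0 $$ (0,0) * mat_delete A i 0 $$ (1,1)
      - mat_delete A i 0 $$ (0,1) * mat_delete A i 0 $$ (1,0)" for i
    by (rule det_dim_2) (use A in \<open>auto simp: mat_delete_def\<close>)
  have "det A = (\<Sum>i<3. A $$ (i,0) * cofactor A i 0)"
    by (rule laplace_expansion_column[OF A]) simp
  also have "{..<3::nat} = {0,1,2}" by auto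
  finally show ?thesis
    unfolding cofactor_def c using A
    by (simp add: mat_delete_def numeral_2_eq_2) (simp add: algebra_simps)
qed

lemma extend_to_permutation:
  fixes f :: "nat \<Rightarrow> nat"
  assumes f: "inj_on f {0..<k}" "f ` {0..<k} \<subseteq> {0..<n}"
  obtains p where "p permutes {0..<n}" "\<And>i. i < k \<Longrightarrow> p i = f i"
proof -
  have kn: "k \<le> n" using card_inj_on_le[OF f] by simp
  have "card ({0..<n} - f ` {0..<k}) = card {k..<n}"
    using f by (simp add: card_Diff_subset card_image)
  then obtain g where g: "bij_betw g {k..<n} ({0..<n} - f ` {0..<k})"
    using finite_same_card_bij[of "{k..<n}" "{0..<n} - f ` {0..<k}"] by auto
  define p where "p i = (if i < k then f i else if i < n then g i else i)" for i
  have "bij_betw p {0..<k} (f ` {0..<k})"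
    by (rule bij_betw_cong[THEN iffD1, OF _ inj_on_imp_bij_betw[OF f(1)]]) (simp add: p_def)
  moreover have "bij_betw p {k..<n} ({0..<n} - f ` {0..<k})"
    by (rule bij_betw_cong[THEN iffD1, OF _ g]) (simp add: p_def)
  ultimately have "bij_betw p ({0..<k} \<union> {k..<n}) (f ` {0..<k} \<union> ({0..<n} - f ` {0..<k}))"
    by (rule bij_betw_combine) blast
  moreover have "{0..<k} \<union> {k..<n} = {0..<n}" "f ` {0..<k} \<union> ({0..<n} - f ` {0..<k}) = {0..<n}"
    using f kn by auto
  ultimately have "p permutes {0..<n}"
    by (intro bij_imp_permutes) (use kn in \<open>auto simp: p_def\<close>)
  then show thesis by (rule that) (simp add: p_def)
qed

text \<open>Skewness turns the relation for \<open>transpose_mat S * S\<close> into \<open>S * S = - (n - 1) I\<close>, which is the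
form in which it is used.\<close>

lemma skew_conferenceD:
  assumes "skew_conference_mat n S"
  shows "S \<in> carrier_mat n n"
    and "\<And>i j. i < n \<Longrightarrow> j < n \<Longrightarrow> S $$ (j,i) = - S $$ (i,j)"
    and "\<And>i. i < n \<Longrightarrow> S $$ (i,i) = 0"
    and "\<And>i j. i < n \<Longrightarrow> j < n \<Longrightarrow> i \<noteq> j \<Longrightarrow> S $$ (i,j) = 1 \<or> S $$ (i,j) = - 1"
    and "\<And>i j. i < n \<Longrightarrow> j < n \<Longrightarrow>
      (\<Sum>l = 0..<n. S $$ (i,l) * S $$ (l,j)) = (if i = j then - of_nat (n - 1) else 0)"
proof -
  have S: "S \<in> carrier_mat n n" and T: "transpose_mat S = - S"
    and O: "transpose_mat S * S = of_nat (n - 1) \<cdot>\<^sub>m 1\<^sub>m n"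
    using assms by (auto simp: skew_conference_mat_def conference_mat_def)
  show "S \<in> carrier_mat n n" by (rule S)
  show skew: "S $$ (j,i) = - S $$ (i,j)" if "i < n" "j < n" for i j
  proof -
    have "transpose_mat S $$ (i,j) = (- S) $$ (i,j)" by (simp add: T)
    then show ?thesis using that S by simp
  qed
  show "\<And>i. i < n \<Longrightarrow> S $$ (i,i) = 0"
    "\<And>i j. i < n \<Longrightarrow> j < n \<Longrightarrow> i \<noteq> j \<Longrightarrow> S $$ (i,j) = 1 \<or> S $$ (i,j) = - 1"
    using assms by (auto simp: skew_conference_mat_def conference_mat_def)
  show "(\<Sum>l = 0..<n. S $$ (i,l) * S $$ (l,j)) = (if i = j then - of_nat (n - 1) else 0)"
    if ij: "i < n" "j < n" for i j
  proof -
    have "(\<Sum>l = 0..<n. S $$ (l,i) * S $$ (l,j)) = (transpose_mat S * S) $$ (i,j)"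
      using S ij by (simp add: scalar_prod_def)
    also have "\<dots> = (if i = j then of_nat (n - 1) else 0)" using ij by (simp add: O)
    finally have "- (\<Sum>l = 0..<n. S $$ (l,i) * S $$ (l,j)) = (if i = j then - of_nat (n - 1) else 0)"
      by simp
    moreover have "(\<Sum>l = 0..<n. S $$ (i,l) * S $$ (l,j)) = - (\<Sum>l = 0..<n. S $$ (l,i) * S $$ (l,j))"
      unfolding sum_negf[symmetric]
    proof (rule sum.cong[OF refl])
      fix l assume "l \<in> {0..<n}"
      then show "S $$ (i,l) * S $$ (l,j) = - (S $$ (l,i) * S $$ (l,j))"
        using skew[of l i] ij by simp
    qed
    ultimately show ?thesis by simp
  qed
qed

text \<open>Jacobi's identity for complementary minors, without inverting a matrix. Permute the indices so that
\<open>f\<close> selects the first \<open>k\<close> of them, put \<open>M = x I - \<i> S\<close>, \<open>N = x I + \<i> S\<close> and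
\<open>q = x^2 - (n - 1)\<close>, so that \<open>M N = q I\<close>. Replacing the first \<open>k\<close> columns of \<open>N\<close> by unit vectors
gives a matrix \<open>E\<close> whose determinant is the lower right minor \<open>W\<close> of \<open>N\<close>, while \<open>M E\<close> is block
triangular with diagonal blocks the leading block \<open>P\<close> of \<open>M\<close> and \<open>q I\<close>. Taking determinants of
\<open>M E\<close> in both ways gives the claim.\<close>

lemma char_poly_principal_skew_conference:
  assumes S: "skew_conference_mat n S" and n: "n = k + 3"
    and f: "inj_on f {0..<k}" "f ` {0..<k} \<subseteq> {0..<n}"
  shows "poly (char_poly (reindex_mat k (\<i> \<cdot>\<^sub>m S) f)) x * (x\<^sup>2 - of_nat (n - 1)) ^ 3
       = poly (char_poly (\<i> \<cdot>\<^sub>m S)) x * (x ^ 3 - 3 * x)"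
proof -
  note SD = skew_conferenceD[OF S]
  obtain p where p: "p permutes {0..<n}" and pf: "\<And>i. i < k \<Longrightarrow> p i = f i"
    using extend_to_permutation[OF f] by blast
  have pn: "p i < n" if "i < n" for i using permutes_in_image[OF p, of i] that by simp
  have peq: "p i = p j \<longleftrightarrow> i = j" for i j using permutes_inj[OF p] by (auto dest: injD)
  define q where "q = x\<^sup>2 - of_nat (n - 1)"
  define s where "s i j = S $$ (p i, p j)" for i j
  have s0: "s i i = 0" if "i < n" for i using SD(3) pn that by (simp add: s_def)
  have sskew: "s j i = - s i j" if "i < n" "j < n" for i j
    using SD(2)[of "p i" "p j"] pn that by (simp add: s_def)
  have s1: "s i j * s i j = 1" if "i < n" "j < n" "i \<noteq> j" for i j
    using SD(4)[of "p i" "p j"] pn peq that by (auto simp: s_def)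
  have ssq: "(\<Sum>l = 0..<n. s i l * s l j) = (if i = j then - of_nat (n - 1) else 0)" if "i < n" "j < n" for i j
    using SD(5)[of "p i" "p j"] sum.permute[OF p, of "\<lambda>l. S $$ (p i, l) * S $$ (l, p j)"] that pn peq
    by (simp add: s_def comp_def)
  define M where "M = mat n n (\<lambda>(i,j). (if i = j then x else 0) - \<i> * s i j)"
  define N where "N = mat n n (\<lambda>(i,j). (if i = j then x else 0) + \<i> * s i j)"
  define E where "E = mat n n (\<lambda>(i,j). if j < k then (if i = j then 1 else 0) else N $$ (i,j))"
  define P where "P = mat k k (\<lambda>(i,j). M $$ (i,j))"
  define W where "W = mat 3 3 (\<lambda>(i,j). N $$ (i + k, j + k))"
  have MN: "(\<Sum>l = 0..<n. M $$ (i,l) * N $$ (l,j)) = (if i = j then q else 0)" if ij: "i < n" "j < n" for i j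
  proof -
    have "(\<Sum>l = 0..<n. M $$ (i,l) * N $$ (l,j)) = (\<Sum>l = 0..<n.
        (if i = l then (if l = j then x * x else 0) else 0) + (if i = l then x * \<i> * s l j else 0)
        - (if l = j then x * \<i> * s i l else 0) + s i l * s l j)"
      using ij by (intro sum.cong refl) (auto simp: M_def N_def algebra_simps)
    also have "\<dots> = (if i = j then x * x else 0) + (\<Sum>l = 0..<n. s i l * s l j)"
      using ij by (simp add: sum.distrib sum_subtractf)
    finally show ?thesis using ssq[OF ij] by (simp add: q_def power2_eq_square)
  qed
  have detM: "det M = poly (char_poly (\<i> \<cdot>\<^sub>m S)) x"
  proof -
    have "M = mat n n (\<lambda>(i,j). (if i = j then x else 0) - reindex_mat n (\<i> \<cdot>\<^sub>m S) p $$ (i,j))"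
      using SD(1) pn by (intro eq_matI) (auto simp: M_def s_def)
    then have "det M = poly (char_poly (reindex_mat n (\<i> \<cdot>\<^sub>m S) p)) x"
      by (simp add: poly_char_poly_eq_det[OF reindex_mat_carrier])
    also have "reindex_mat n (\<i> \<cdot>\<^sub>m S) id = \<i> \<cdot>\<^sub>m S"
      using SD(1) by (intro eq_matI) auto
    then have "char_poly (reindex_mat n (\<i> \<cdot>\<^sub>m S) p) = char_poly (\<i> \<cdot>\<^sub>m S)"
      using char_poly_reindex_same_image[of p n id "\<i> \<cdot>\<^sub>m S"] permutes_inj_on[OF p] permutes_image[OF p]
      by simp
    finally show ?thesis .
  qed
  have detP: "det P = poly (char_poly (reindex_mat k (\<i> \<cdot>\<^sub>m S) f)) x"
  proof -
    have "P = mat k k (\<lambda>(i,j). (if i = j then x else 0) - reindex_mat k (\<i> \<cdot>\<^sub>m S) f $$ (i,j))"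
    proof (rule eq_matI)
      fix i j assume "i < dim_row (mat k k (\<lambda>(i,j). (if i = j then x else 0) - reindex_mat k (\<i> \<cdot>\<^sub>m S) f $$ (i,j)))"
        "j < dim_col (mat k k (\<lambda>(i,j). (if i = j then x else 0) - reindex_mat k (\<i> \<cdot>\<^sub>m S) f $$ (i,j)))"
      then have ij: "i < k" "j < k" by auto
      then have "f i < n" "f j < n" using pn[of i] pn[of j] pf n by auto
      then show "P $$ (i,j) = mat k k (\<lambda>(i,j). (if i = j then x else 0) - reindex_mat k (\<i> \<cdot>\<^sub>m S) f $$ (i,j)) $$ (i,j)"
        using ij n SD(1) pf by (auto simp: P_def M_def s_def)
    qed (auto simp: P_def)
    then show ?thesis by (simp add: poly_char_poly_eq_det[OF reindex_mat_carrier])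
  qed
  \<comment> \<open>Skew minors of order 3 vanish, so besides \<open>x^3\<close> only the three minors of order 2 contribute.\<close>
  have detW: "det W = x ^ 3 - 3 * x"
  proof -
    have W: "W \<in> carrier_mat 3 3" by (simp add: W_def)
    have idx: "W $$ (i,j) = (if i = j then x else 0) + \<i> * s (i + k) (j + k)" if "i < 3" "j < 3" for i j
      using that n by (simp add: W_def N_def)
    define a b c where "a = s k (Suc k)" and "b = s k (Suc (Suc k))" and "c = s (Suc k) (Suc (Suc k))"
    have abc: "a * a = 1" "b * b = 1" "c * c = 1"
      using n by (auto simp: a_def b_def c_def intro!: s1)
    have sym: "s (Suc k) k = - a" "s (Suc (Suc k)) k = - b" "s (Suc (Suc k)) (Suc k) = - c"
      using n by (auto simp: a_def b_def c_def intro!: sskew)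
    have zero: "s k k = 0" "s (Suc k) (Suc k) = 0" "s (Suc (Suc k)) (Suc (Suc k)) = 0"
      using n by (auto intro!: s0)
    have "det W = x * (x * x - c * c) - a * a * x - b * b * x"
      unfolding det_dim_3[OF W]
      by (simp add: idx sym zero flip: a_def b_def c_def) (simp add: algebra_simps)
    then show ?thesis by (simp add: abc power3_eq_cube algebra_simps)
  qed
  have "E = four_block_mat (1\<^sub>m k) (mat k 3 (\<lambda>(i,j). N $$ (i, j + k))) (0\<^sub>m 3 k) W"
    using n by (intro eq_matI) (auto simp: E_def W_def)
  then have detE: "det E = det W"
    by (simp add: det_four_block_mat_lower_left_zero[of _ k _ 3] W_def)
  have ME: "M * E = four_block_mat P (0\<^sub>m k 3) (mat 3 k (\<lambda>(i,j). M $$ (i + k, j))) (q \<cdot>\<^sub>m 1\<^sub>m 3)"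
  proof (rule eq_matI)
    let ?R = "four_block_mat P (0\<^sub>m k 3) (mat 3 k (\<lambda>(i,j). M $$ (i + k, j))) (q \<cdot>\<^sub>m 1\<^sub>m 3)"
    fix i j assume "i < dim_row ?R" "j < dim_col ?R"
    then have ij: "i < n" "j < n" using n by (auto simp: P_def)
    have "(M * E) $$ (i,j) = (\<Sum>l = 0..<n. M $$ (i,l) * E $$ (l,j))"
      using ij by (simp add: M_def E_def scalar_prod_def)
    also have "\<dots> = (if j < k then M $$ (i,j) else if i = j then q else 0)"
    proof (cases "j < k")
      case True
      have "(\<Sum>l = 0..<n. M $$ (i,l) * E $$ (l,j)) = (\<Sum>l = 0..<n. if l = j then M $$ (i,l) else 0)"
        using ij True by (intro sum.cong refl) (auto simp: E_def)
      then show ?thesis using ij True by simp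
    next
      case False
      have "(\<Sum>l = 0..<n. M $$ (i,l) * E $$ (l,j)) = (\<Sum>l = 0..<n. M $$ (i,l) * N $$ (l,j))"
        using ij False by (intro sum.cong refl) (auto simp: E_def)
      then show ?thesis using MN[OF ij] False by simp
    qed
    finally show "(M * E) $$ (i,j) = ?R $$ (i,j)" using ij n by (auto simp: P_def)
  qed (use n in \<open>auto simp: M_def E_def P_def\<close>)
  have "det (M * E) = det P * q ^ 3"
    unfolding ME by (subst det_four_block_mat_upper_right_zero[of _ k _ 3]) (auto simp: P_def)
  moreover have "det (M * E) = det M * det E"
    by (rule det_mult[of _ n]) (auto simp: M_def E_def)
  ultimately show ?thesis
    by (simp add: detM detP detE detW q_def)
qed

lemma skew_conference_spectrally_monomorphic:
  assumes S: "skew_conference_mat n S" and n: "n \<ge> 3"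
  shows "spectrally_monomorphic n (n - 3) (\<i> \<cdot>\<^sub>m S)"
proof -
  have carr: "\<i> \<cdot>\<^sub>m S \<in> carrier_mat n n" using skew_conferenceD(1)[OF S] by simp
  let ?k = "n - 3"
  have nk: "n = ?k + 3" using n by simp
  have "char_poly (reindex_mat ?k (\<i> \<cdot>\<^sub>m S) f) = char_poly (reindex_mat ?k (\<i> \<cdot>\<^sub>m S) g)"
    if f: "inj_on f {0..<?k}" "f ` {0..<?k} \<subseteq> {0..<n}" and g: "inj_on g {0..<?k}" "g ` {0..<?k} \<subseteq> {0..<n}" for f g
  proof -
    \<comment> \<open>The factor \<open>x^2 - (n - 1)\<close> has roots, so it is cancelled in the polynomial ring.\<close>
    let ?Q = "[:- of_nat (n - 1), 0, 1:] :: complex poly"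
    have Q: "poly ?Q x = x\<^sup>2 - of_nat (n - 1)" for x
      by (simp add: power2_eq_square algebra_simps)
    have "char_poly (reindex_mat ?k (\<i> \<cdot>\<^sub>m S) f) * ?Q ^ 3 = char_poly (reindex_mat ?k (\<i> \<cdot>\<^sub>m S) g) * ?Q ^ 3"
      by (rule poly_ext)
        (simp only: poly_mult poly_power Q char_poly_principal_skew_conference[OF S nk f]
          char_poly_principal_skew_conference[OF S nk g])
    then show ?thesis by simp
  qed
  then show ?thesis unfolding spectrally_monomorphic_iff_reindex[OF carr] by blast
qed

section \<open>From constant subset sums to weighted designs\<close>

text \<open>In the sum of \<open>F (X - {x})\<close> over \<open>x \<in> X\<close> each \<open>j\<close>-subset \<open>B\<close> of \<open>X\<close> is counted once for
every element of \<open>X - B\<close>, so this sum is \<open>(card X - j) * F X\<close>. Constancy on the sets of one size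
therefore passes to the next size.\<close>

lemma sum_subsets_upward:
  fixes f :: "'a set \<Rightarrow> 'b :: field_char_0"
  assumes V: "finite V" and jk: "j \<le> k"
    and const: "\<And>\<alpha> \<beta>. \<alpha> \<subseteq> V \<Longrightarrow> \<beta> \<subseteq> V \<Longrightarrow> card \<alpha> = k \<Longrightarrow> card \<beta> = k \<Longrightarrow>
      (\<Sum>B | B \<subseteq> \<alpha> \<and> card B = j. f B) = (\<Sum>B | B \<subseteq> \<beta> \<and> card B = j. f B)"
    and km: "k \<le> m" and ab: "\<alpha> \<subseteq> V" "\<beta> \<subseteq> V" "card \<alpha> = m" "card \<beta> = m"
  shows "(\<Sum>B | B \<subseteq> \<alpha> \<and> card B = j. f B) = (\<Sum>B | B \<subseteq> \<beta> \<and> card B = j. f B)"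
  using km ab
proof (induction m arbitrary: \<alpha> \<beta> rule: dec_induct)
  case base
  then show ?case by (intro const)
next
  case (step m)
  define F where "F X = (\<Sum>B | B \<subseteq> X \<and> card B = j. f B)" for X
  have double: "(\<Sum>x\<in>X. F (X - {x})) = of_nat (Suc m - j) * F X" if X: "X \<subseteq> V" "card X = Suc m" for X
  proof -
    have fin: "finite X" using X V finite_subset by blast
    have sub: "{B. B \<subseteq> X - {x} \<and> card B = j} = {B \<in> {B. B \<subseteq> X \<and> card B = j}. x \<notin> B}" for x by auto
    have "(\<Sum>x\<in>X. F (X - {x})) = (\<Sum>x\<in>X. \<Sum>B | B \<in> {B. B \<subseteq> X \<and> card B = j} \<and> x \<notin> B. f B)"
      unfolding F_def sub ..
    also have "\<dots> = (\<Sum>B | B \<subseteq> X \<and> card B = j. \<Sum>x | x \<in> X \<and> x \<notin> B. f B)"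
      by (rule sum.swap_restrict) (use fin in auto)
    also have "\<dots> = (\<Sum>B | B \<subseteq> X \<and> card B = j. of_nat (Suc m - j) * f B)"
    proof (rule sum.cong[OF refl])
      fix B assume B: "B \<in> {B. B \<subseteq> X \<and> card B = j}"
      have "{x. x \<in> X \<and> x \<notin> B} = X - B" by auto
      moreover have "card (X - B) = Suc m - j"
        using B X fin finite_subset[of B X] by (auto simp: card_Diff_subset)
      ultimately show "(\<Sum>x | x \<in> X \<and> x \<notin> B. f B) = of_nat (Suc m - j) * f B" by simp
    qed
    finally show ?thesis by (simp add: F_def sum_distrib_left)
  qed
  obtain x where "x \<in> \<alpha>" using step.prems(3) by fastforce
  define c where "c = F (\<alpha> - {x})"
  have c: "F (X - {y}) = c" if "X \<subseteq> V" "card X = Suc m" "y \<in> X" for X y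
    unfolding c_def F_def
    by (rule step.IH) (use that step.prems \<open>x \<in> \<alpha>\<close> in auto)
  have "of_nat (Suc m - j) * F X = of_nat (Suc m) * c" if X: "X \<subseteq> V" "card X = Suc m" for X
    unfolding double[OF X, symmetric] using c[OF X] X by simp
  then have "(of_nat (Suc m - j) :: 'b) * F \<alpha> = of_nat (Suc m - j) * F \<beta>"
    using step.prems by metis
  moreover have "(of_nat (Suc m - j) :: 'b) \<noteq> 0"
    using jk step.hyps by (simp only: of_nat_eq_0_iff)
  ultimately show ?case unfolding F_def by simp
qed

text \<open>Inclusion and exclusion, one element at a time: the sets containing \<open>S\<close> and \<open>x\<close> are those
containing \<open>S\<close> without those that avoid \<open>x\<close>. Each element of \<open>T\<close> costs one step down from the ambient set, so
\<open>card V - k\<close> elements are available. The induction needs ambient sets smaller than \<open>V\<close>.\<close>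

lemma sum_supersets_const:
  fixes f :: "'a set \<Rightarrow> 'b :: field_char_0"
  assumes V: "finite V" and jk: "j \<le> k"
    and const: "\<And>\<alpha> \<beta>. \<alpha> \<subseteq> V \<Longrightarrow> \<beta> \<subseteq> V \<Longrightarrow> card \<alpha> = k \<Longrightarrow> card \<beta> = k \<Longrightarrow>
      (\<Sum>B | B \<subseteq> \<alpha> \<and> card B = j. f B) = (\<Sum>B | B \<subseteq> \<beta> \<and> card B = j. f B)"
    and T: "T \<subseteq> V" "T' \<subseteq> V" "card T = t" "card T' = t" and t: "k + t \<le> card V"
  shows "(\<Sum>B | T \<subseteq> B \<and> B \<subseteq> V \<and> card B = j. f B) = (\<Sum>B | T' \<subseteq> B \<and> B \<subseteq> V \<and> card B = j. f B)"
proof -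
  have "(\<Sum>B | T \<subseteq> B \<and> B \<subseteq> \<alpha> \<and> card B = j. f B) = (\<Sum>B | T' \<subseteq> B \<and> B \<subseteq> \<beta> \<and> card B = j. f B)"
    if "T \<subseteq> \<alpha>" "T' \<subseteq> \<beta>" "card T = t" "card T' = t" "\<alpha> \<subseteq> V" "\<beta> \<subseteq> V" "card \<alpha> = card \<beta>" "k + t \<le> card \<alpha>"
    for T T' \<alpha> \<beta>
    using that
  proof (induction t arbitrary: T T' \<alpha> \<beta>)
    case 0
    have "finite T" "finite T'" using 0 V by (meson finite_subset)+
    then have "T = {}" "T' = {}" using 0 by auto
    moreover have "(\<Sum>B | B \<subseteq> \<alpha> \<and> card B = j. f B) = (\<Sum>B | B \<subseteq> \<beta> \<and> card B = j. f B)"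
      by (rule sum_subsets_upward[OF V jk const, where m = "card \<alpha>"]) (use 0 in auto)
    ultimately show ?case by simp
  next
    case (Suc t)
    have remove: "(\<Sum>B | insert x S \<subseteq> B \<and> B \<subseteq> X \<and> card B = j. f B)
        = (\<Sum>B | S \<subseteq> B \<and> B \<subseteq> X \<and> card B = j. f B) - (\<Sum>B | S \<subseteq> B \<and> B \<subseteq> X - {x} \<and> card B = j. f B)"
      if "X \<subseteq> V" for x S X
    proof -
      have fin: "finite X" using V that finite_subset by blast
      have "{B. S \<subseteq> B \<and> B \<subseteq> X \<and> card B = j}
          = {B. insert x S \<subseteq> B \<and> B \<subseteq> X \<and> card B = j} \<union> {B. S \<subseteq> B \<and> B \<subseteq> X - {x} \<and> card B = j}"
        by auto
      moreover have "finite {B. insert x S \<subseteq> B \<and> B \<subseteq> X \<and> card B = j}"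
        "finite {B. S \<subseteq> B \<and> B \<subseteq> X - {x} \<and> card B = j}"
        using fin by auto
      moreover have "{B. insert x S \<subseteq> B \<and> B \<subseteq> X \<and> card B = j} \<inter> {B. S \<subseteq> B \<and> B \<subseteq> X - {x} \<and> card B = j} = {}"
        by auto
      ultimately show ?thesis by (simp add: sum.union_disjoint)
    qed
    obtain x S where x: "T = insert x S" "x \<notin> S" "card S = t"
      using Suc.prems(3) by (metis card_Suc_eq)
    obtain y S' where y: "T' = insert y S'" "y \<notin> S'" "card S' = t"
      using Suc.prems(4) by (metis card_Suc_eq)
    have "(\<Sum>B | S \<subseteq> B \<and> B \<subseteq> \<alpha> \<and> card B = j. f B) = (\<Sum>B | S' \<subseteq> B \<and> B \<subseteq> \<beta> \<and> card B = j. f B)"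
      by (rule Suc.IH) (use Suc.prems x y in auto)
    moreover have "(\<Sum>B | S \<subseteq> B \<and> B \<subseteq> \<alpha> - {x} \<and> card B = j. f B) = (\<Sum>B | S' \<subseteq> B \<and> B \<subseteq> \<beta> - {y} \<and> card B = j. f B)"
      by (rule Suc.IH) (use Suc.prems x y in auto)
    ultimately show ?case
      unfolding x(1) y(1) using remove Suc.prems by simp
  qed
  from this[of T V T' V] show ?thesis using T t by simp
qed

lemma sum_permutations_of_set:
  assumes "finite A" "A \<noteq> {}"
  shows "(\<Sum>w \<in> permutations_of_set A. g w) = (\<Sum>x\<in>A. \<Sum>w \<in> permutations_of_set (A - {x}). g (x # w))"
proof -
  have "(\<Sum>w \<in> permutations_of_set A. g w)
      = (\<Sum>x\<in>A. \<Sum>w \<in> (\<lambda>w. x # w) ` permutations_of_set (A - {x}). g w)"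
    unfolding permutations_of_set_nonempty[OF assms(2)]
    by (rule sum.UNION_disjoint) (use assms in auto)
  also have "\<dots> = (\<Sum>x\<in>A. \<Sum>w \<in> permutations_of_set (A - {x}). g (x # w))"
    by (rule sum.cong[OF refl]) (simp add: sum.reindex)
  finally show ?thesis .
qed

lemma sum_words_distinct:
  assumes X: "finite X" and g: "\<And>w. length w = j \<Longrightarrow> set w \<subseteq> X \<Longrightarrow> \<not> distinct w \<Longrightarrow> g w = 0"
  shows "(\<Sum>w \<in> words X j. g w) = (\<Sum>B | B \<subseteq> X \<and> card B = j. \<Sum>w \<in> permutations_of_set B. g w)"
proof -
  let ?D = "{w. set w \<subseteq> X \<and> length w = j \<and> distinct w}"
  have fin: "finite (words X j)" using X by (rule finite_lists_length_eq)
  have "(\<Sum>w \<in> words X j. g w) = (\<Sum>w \<in> ?D. g w)"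
    by (rule sum.mono_neutral_right[OF fin]) (use g in auto)
  also have "?D = (\<Union>B \<in> {B. B \<subseteq> X \<and> card B = j}. permutations_of_set B)"
    by (auto simp: permutations_of_set_def distinct_card)
  also have "(\<Sum>w \<in> \<dots>. g w) = (\<Sum>B | B \<subseteq> X \<and> card B = j. \<Sum>w \<in> permutations_of_set B. g w)"
    by (rule sum.UNION_disjoint) (use X in \<open>auto dest: permutations_of_setD(1)\<close>)
  finally show ?thesis .
qed

text \<open>Grouping words by their set of letters turns them into \<open>j\<close>-subsets. The weights of
the single arrangements of a set stay summed up, since traces only determine their total.\<close>

lemma word_sum_design:
  fixes g :: "'a list \<Rightarrow> 'b :: field_char_0"
  assumes V: "finite V" and jk: "j \<le> k"
    and g: "\<And>w. length w = j \<Longrightarrow> set w \<subseteq> V \<Longrightarrow> \<not> distinct w \<Longrightarrow> g w = 0"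
    and const: "\<And>\<alpha> \<beta>. \<alpha> \<subseteq> V \<Longrightarrow> \<beta> \<subseteq> V \<Longrightarrow> card \<alpha> = k \<Longrightarrow> card \<beta> = k \<Longrightarrow>
      (\<Sum>w \<in> words \<alpha> j. g w) = (\<Sum>w \<in> words \<beta> j. g w)"
    and T: "T \<subseteq> V" "T' \<subseteq> V" "card T = t" "card T' = t" and t: "k + t \<le> card V"
  shows "(\<Sum>B | T \<subseteq> B \<and> B \<subseteq> V \<and> card B = j. \<Sum>w \<in> permutations_of_set B. g w)
       = (\<Sum>B | T' \<subseteq> B \<and> B \<subseteq> V \<and> card B = j. \<Sum>w \<in> permutations_of_set B. g w)"
proof (rule sum_supersets_const[OF V jk _ T t])
  fix \<alpha> \<beta> assume ab: "\<alpha> \<subseteq> V" "\<beta> \<subseteq> V" "card \<alpha> = k" "card \<beta> = k"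
  have "(\<Sum>w \<in> words X j. g w) = (\<Sum>B | B \<subseteq> X \<and> card B = j. \<Sum>w \<in> permutations_of_set B. g w)"
    if "X \<subseteq> V" for X
    by (rule sum_words_distinct) (use that V g finite_subset in auto)
  then show "(\<Sum>B | B \<subseteq> \<alpha> \<and> card B = j. \<Sum>w \<in> permutations_of_set B. g w)
      = (\<Sum>B | B \<subseteq> \<beta> \<and> card B = j. \<Sum>w \<in> permutations_of_set B. g w)"
    using const[OF ab] ab by simp
qed

text \<open>The two cases that occur later: the design property speaks about the sets \<open>T\<close> themselves when
\<open>j = card T\<close>, and about extensions of \<open>T\<close> by one point when \<open>j = Suc (card T)\<close>.\<close>

lemma sum_supersets_same_card:
  assumes V: "finite V" and T: "T \<subseteq> V"
  shows "(\<Sum>B | T \<subseteq> B \<and> B \<subseteq> V \<and> card B = card T. F B) = F T"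
proof -
  have "T = B" if "T \<subseteq> B" "B \<subseteq> V" "card B = card T" for B
    using card_subset_eq[OF finite_subset[OF that(2) V], of T] that by simp
  then have "{B. T \<subseteq> B \<and> B \<subseteq> V \<and> card B = card T} = {T}"
    using T by blast
  then show ?thesis by simp
qed

lemma sum_supersets_Suc_card:
  assumes V: "finite V" and T: "T \<subseteq> V"
  shows "(\<Sum>B | T \<subseteq> B \<and> B \<subseteq> V \<and> card B = Suc (card T). F B) = (\<Sum>z \<in> V - T. F (insert z T))"
proof -
  have finT: "finite T" using V T finite_subset by blast
  have eq: "{B. T \<subseteq> B \<and> B \<subseteq> V \<and> card B = Suc (card T)} = (\<lambda>z. insert z T) ` (V - T)" (is "?L = ?R")
  proof
    show "?R \<subseteq> ?L" using finT T by auto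
    show "?L \<subseteq> ?R"
    proof
      fix B assume B: "B \<in> ?L"
      have "card (B - T) = 1" using B finT by (simp add: card_Diff_subset)
      then obtain z where "B - T = {z}" by (auto simp: card_1_singleton_iff)
      then have "B = insert z T" "z \<in> V - T" using B by auto
      then show "B \<in> ?R" by blast
    qed
  qed
  have "inj_on (\<lambda>z. insert z T) (V - T)" by (rule inj_onI) blast
  then show ?thesis unfolding eq by (simp add: sum.reindex)
qed

section \<open>Invariants of monomorphic matrices\<close>

lemma sum_permutations_2:
  "a \<noteq> b \<Longrightarrow> (\<Sum>w \<in> permutations_of_set {a,b}. g w) = g [a,b] + g [b,a]"
  by (simp add: permutations_of_set_doubleton)

lemma sum_permutations_3:
  assumes "a \<noteq> b" "b \<noteq> c" "c \<noteq> a"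
  shows "(\<Sum>w \<in> permutations_of_set {a,b,c}. g w)
    = g [a,b,c] + g [a,c,b] + g [b,a,c] + g [b,c,a] + g [c,a,b] + g [c,b,a]"
proof -
  have "{a,b,c} - {a} = {b,c}" "{a,b,c} - {b} = {a,c}" "{a,b,c} - {c} = {a,b}"
    using assms by auto
  then show ?thesis
    using assms by (subst sum_permutations_of_set) (auto simp: sum_permutations_2 add.assoc)
qed

lemma sum_permutations_4:
  assumes "distinct [a,b,c,d]"
  shows "(\<Sum>w \<in> permutations_of_set {a,b,c,d}. g w)
    = g [a,b,c,d] + g [a,b,d,c] + g [a,c,b,d] + g [a,c,d,b] + g [a,d,b,c] + g [a,d,c,b]
    + g [b,a,c,d] + g [b,a,d,c] + g [b,c,a,d] + g [b,c,d,a] + g [b,d,a,c] + g [b,d,c,a]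
    + g [c,a,b,d] + g [c,a,d,b] + g [c,b,a,d] + g [c,b,d,a] + g [c,d,a,b] + g [c,d,b,a]
    + g [d,a,b,c] + g [d,a,c,b] + g [d,b,a,c] + g [d,b,c,a] + g [d,c,a,b] + g [d,c,b,a]"
proof -
  have "{a,b,c,d} - {a} = {b,c,d}" "{a,b,c,d} - {b} = {a,c,d}" "{a,b,c,d} - {c} = {a,b,d}"
    "{a,b,c,d} - {d} = {a,b,c}"
    using assms by auto
  moreover have "a \<noteq> b" "a \<noteq> c" "a \<noteq> d" "b \<noteq> c" "b \<noteq> d" "c \<noteq> d"
    "b \<noteq> a" "c \<noteq> a" "d \<noteq> a" "c \<noteq> b" "d \<noteq> b" "d \<noteq> c"
    using assms by auto
  ultimately show ?thesis
    by (subst sum_permutations_of_set) (simp_all add: sum_permutations_3 add.assoc)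
qed

text \<open>Traces involve all closed walks, while the design property needs walks with distinct vertices.
Subtracting the walks of a second monomorphic matrix \<open>B\<close> that agrees with \<open>A\<close> on the degenerate
walks removes them: for walks of length up to 3 in a matrix with zero diagonal \<open>B = 0\<close> will do, for
length 4 the matrix \<open>Hn n 1\<close>.\<close>

lemma monomorphic_cycle_design:
  assumes A: "A \<in> carrier_mat n n" and mono: "spectrally_monomorphic n (n - 3) A"
    and B: "B \<in> carrier_mat n n" "spectrally_monomorphic n (n - 3) B"
    and n: "n \<ge> 7" and m: "m \<le> 3"
    and eq: "\<And>w. length w = Suc m \<Longrightarrow> set w \<subseteq> {0..<n} \<Longrightarrow> \<not> distinct w \<Longrightarrow>
      cycle_weight (\<lambda>i j. A $$ (i,j)) w = cycle_weight (\<lambda>i j. B $$ (i,j)) w"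
    and T: "T \<subseteq> {0..<n}" "T' \<subseteq> {0..<n}" "card T = t" "card T' = t" and t: "t \<le> 3"
  defines "g \<equiv> \<lambda>w. cycle_weight (\<lambda>i j. A $$ (i,j)) w - cycle_weight (\<lambda>i j. B $$ (i,j)) w"
  shows "(\<Sum>X | T \<subseteq> X \<and> X \<subseteq> {0..<n} \<and> card X = Suc m. \<Sum>w \<in> permutations_of_set X. g w)
       = (\<Sum>X | T' \<subseteq> X \<and> X \<subseteq> {0..<n} \<and> card X = Suc m. \<Sum>w \<in> permutations_of_set X. g w)"
proof (rule word_sum_design[where k = "n - 3", OF _ _ _ _ T])
  show "g w = 0" if "length w = Suc m" "set w \<subseteq> {0..<n}" "\<not> distinct w" for w
    using eq[OF that] by (simp add: g_def)
  show "(\<Sum>w \<in> words \<alpha> (Suc m). g w) = (\<Sum>w \<in> words \<beta> (Suc m). g w)"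
    if "\<alpha> \<subseteq> {0..<n}" "\<beta> \<subseteq> {0..<n}" "card \<alpha> = n - 3" "card \<beta> = n - 3" for \<alpha> \<beta>
    unfolding g_def sum_subtractf
    using spectrally_monomorphic_cycle_sums[OF A mono that(1,3,2,4)]
      spectrally_monomorphic_cycle_sums[OF B that(1,3,2,4)] by metis
qed (use n m t in auto)

lemma Hn_0: "Hn n 0 = 0\<^sub>m n n"
  by (intro eq_matI) (auto simp: Hn_def)

lemma cycle_weight_zero: "cycle_weight (\<lambda>i j. 0) w = 0"
proof (cases w)
  case (Cons a v)
  then show ?thesis by (cases v) auto
qed simp

lemma monomorphic_cycle_sum_const:
  assumes A: "A \<in> carrier_mat n n" and mono: "spectrally_monomorphic n (n - 3) A"
    and n: "n \<ge> 7" and T: "T \<subseteq> {0..<n}" "T' \<subseteq> {0..<n}" "card T = t" "card T' = t" and t: "1 \<le> t" "t \<le> 3"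
    and zero: "\<And>w. length w = t \<Longrightarrow> set w \<subseteq> {0..<n} \<Longrightarrow> \<not> distinct w \<Longrightarrow>
      cycle_weight (\<lambda>i j. A $$ (i,j)) w = 0"
  shows "(\<Sum>w \<in> permutations_of_set T. cycle_weight (\<lambda>i j. A $$ (i,j)) w)
       = (\<Sum>w \<in> permutations_of_set T'. cycle_weight (\<lambda>i j. A $$ (i,j)) w)"
proof -
  have B: "Hn n 0 \<in> carrier_mat n n" by (simp add: Hn_0)
  have c0: "cycle_weight (\<lambda>i j. Hn n 0 $$ (i,j)) w = 0" if "set w \<subseteq> {0..<n}" for w
  proof (cases w)
    case (Cons a v)
    have "walk_weight (\<lambda>i j. Hn n 0 $$ (i,j)) a v a = walk_weight (\<lambda>i j. 0) a v a"
      by (rule walk_weight_cong) (use that Cons in \<open>auto simp: Hn_0 subset_iff\<close>)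
    then show ?thesis using Cons cycle_weight_zero[of w] by simp
  qed simp
  have sub: "set w \<subseteq> {0..<n}" if "w \<in> permutations_of_set X" "X \<subseteq> {0..<n}" for w X
    using that permutations_of_setD(1) by blast
  note * = monomorphic_cycle_design[OF A mono B Hn_spectrally_monomorphic n, of "t - 1", OF _ _ T]
  have Suc: "Suc (t - 1) = t" using t by simp
  have V: "finite {0..<n}" by simp
  let ?g = "\<lambda>w. cycle_weight (\<lambda>i j. A $$ (i,j)) w - cycle_weight (\<lambda>i j. Hn n 0 $$ (i,j)) w"
  have "(\<Sum>X | T \<subseteq> X \<and> X \<subseteq> {0..<n} \<and> card X = t. \<Sum>w \<in> permutations_of_set X. ?g w)
      = (\<Sum>X | T' \<subseteq> X \<and> X \<subseteq> {0..<n} \<and> card X = t. \<Sum>w \<in> permutations_of_set X. ?g w)"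
    by (rule *[unfolded Suc]) (use t zero c0 in auto)
  then have "(\<Sum>w \<in> permutations_of_set T. ?g w) = (\<Sum>w \<in> permutations_of_set T'. ?g w)"
    unfolding sum_supersets_same_card[OF V T(1), unfolded T(3)]
      sum_supersets_same_card[OF V T(2), unfolded T(4)] .
  then show ?thesis
    using c0 sub T(1,2) by simp
qed

lemma monomorphic_diag_const:
  assumes A: "A \<in> carrier_mat n n" and mono: "spectrally_monomorphic n (n - 3) A"
    and n: "n \<ge> 7" and "i < n" "j < n"
  shows "A $$ (i,i) = A $$ (j,j)"
proof -
  have "(\<Sum>w \<in> permutations_of_set {i}. cycle_weight (\<lambda>i j. A $$ (i,j)) w)
       = (\<Sum>w \<in> permutations_of_set {j}. cycle_weight (\<lambda>i j. A $$ (i,j)) w)"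
  proof (rule monomorphic_cycle_sum_const[OF A mono n, of _ _ 1])
    fix w :: "nat list" assume "length w = 1" "\<not> distinct w"
    then show "cycle_weight (\<lambda>i j. A $$ (i,j)) w = 0" by (cases w) auto
  qed (use assms in auto)
  then show ?thesis by simp
qed

lemma monomorphic_pair_const:
  assumes A: "A \<in> carrier_mat n n" and mono: "spectrally_monomorphic n (n - 3) A"
    and n: "n \<ge> 7" and zero: "\<And>i. i < n \<Longrightarrow> A $$ (i,i) = 0"
    and x: "x < n" "y < n" "x \<noteq> y" and u: "u < n" "v < n" "u \<noteq> v"
  shows "A $$ (x,y) * A $$ (y,x) = A $$ (u,v) * A $$ (v,u)"
proof -
  have "(\<Sum>w \<in> permutations_of_set {x,y}. cycle_weight (\<lambda>i j. A $$ (i,j)) w)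
       = (\<Sum>w \<in> permutations_of_set {u,v}. cycle_weight (\<lambda>i j. A $$ (i,j)) w)"
  proof (rule monomorphic_cycle_sum_const[OF A mono n, of _ _ 2])
    fix w :: "nat list" assume "length w = 2" "\<not> distinct w" "set w \<subseteq> {0..<n}"
    then show "cycle_weight (\<lambda>i j. A $$ (i,j)) w = 0"
      using zero by (auto simp: length_Suc_conv numeral_2_eq_2)
  qed (use x u in auto)
  then show ?thesis using x u by (simp add: permutations_of_set_doubleton mult.commute)
qed

lemma monomorphic_triple_const:
  assumes A: "A \<in> carrier_mat n n" and mono: "spectrally_monomorphic n (n - 3) A"
    and n: "n \<ge> 7" and zero: "\<And>i. i < n \<Longrightarrow> A $$ (i,i) = 0"
    and x: "x < n" "y < n" "z < n" "x \<noteq> y" "y \<noteq> z" "z \<noteq> x"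
    and u: "u < n" "v < n" "w < n" "u \<noteq> v" "v \<noteq> w" "w \<noteq> u"
  shows "A $$ (x,y) * A $$ (y,z) * A $$ (z,x) + A $$ (x,z) * A $$ (z,y) * A $$ (y,x)
       = A $$ (u,v) * A $$ (v,w) * A $$ (w,u) + A $$ (u,w) * A $$ (w,v) * A $$ (v,u)"
proof -
  have sum3: "(\<Sum>l \<in> permutations_of_set {a,b,c}. cycle_weight (\<lambda>i j. A $$ (i,j)) l)
    = 3 * (A $$ (a,b) * A $$ (b,c) * A $$ (c,a) + A $$ (a,c) * A $$ (c,b) * A $$ (b,a))"
    if "a \<noteq> b" "b \<noteq> c" "c \<noteq> a" for a b c
    using that by (simp add: sum_permutations_3 algebra_simps)
  have "(\<Sum>l \<in> permutations_of_set {x,y,z}. cycle_weight (\<lambda>i j. A $$ (i,j)) l)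
       = (\<Sum>l \<in> permutations_of_set {u,v,w}. cycle_weight (\<lambda>i j. A $$ (i,j)) l)"
  proof (rule monomorphic_cycle_sum_const[OF A mono n, of _ _ 3])
    fix l :: "nat list" assume "length l = 3" "\<not> distinct l" "set l \<subseteq> {0..<n}"
    then show "cycle_weight (\<lambda>i j. A $$ (i,j)) l = 0"
      using zero by (auto simp: length_Suc_conv numeral_3_eq_3)
  qed (use x u in auto)
  then show ?thesis unfolding sum3[OF x(4-6)] sum3[OF u(4-6)] by (simp only: mult_cancel_left) simp
qed

text \<open>Four points carry three cyclic orders, each with 8 arrangements as a word, and reversing a cycle of
even length does not change its weight.\<close>

lemma sum_4_cycles_skew:
  fixes s :: "nat \<Rightarrow> nat \<Rightarrow> 'a :: comm_ring_1"
  assumes skew: "\<And>i j. s j i = - s i j" and d: "distinct [u, x, y, z]"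
  shows "(\<Sum>w \<in> permutations_of_set {u,x,y,z}. cycle_weight s w)
    = 8 * (s u x * s x y * s y z * s z u + s u x * s x z * s z y * s y u + s u y * s y x * s x z * s z u)"
proof -
  have sw: "s x u = - s u x" "s y u = - s u y" "s z u = - s u z" "s y x = - s x y" "s z x = - s x z" "s z y = - s y z"
    by (rule skew)+
  show ?thesis
    unfolding sum_permutations_4[OF d]
    by (simp add: sw algebra_simps)
qed

text \<open>When row 0 consists of ones, the sum of the three 4-cycles through \<open>0, x, y, z\<close> is
minus the summand below, which is 3 if \<open>x, y, z\<close> form a cyclic triangle and \<open>- 1\<close> otherwise. So the
conclusion says that each pair \<open>x, y\<close> lies in the same number of cyclic triangles.\<close>

lemma monomorphic_skew_design:
  fixes s :: "nat \<Rightarrow> nat \<Rightarrow> real"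
  assumes mono: "spectrally_monomorphic n (n - 3) (mat n n (\<lambda>(i,j). \<i> * of_real (s i j)))"
    and n: "n \<ge> 7" and skew: "\<And>i j. s j i = - s i j"
    and one: "\<And>i j. i < n \<Longrightarrow> j < n \<Longrightarrow> i \<noteq> j \<Longrightarrow> s i j = 1 \<or> s i j = - 1"
    and s0: "\<And>j. 0 < j \<Longrightarrow> j < n \<Longrightarrow> s 0 j = 1"
  obtains K where "\<And>x y. x \<in> {1..<n} \<Longrightarrow> y \<in> {1..<n} \<Longrightarrow> x \<noteq> y \<Longrightarrow>
    (\<Sum>z \<in> {1..<n} - {x,y}. s x y * s y z + s y z * s z x + s z x * s x y) = K"
proof -
  let ?A = "mat n n (\<lambda>(i,j). \<i> * complex_of_real (s i j))"
  let ?B = "Hn n 1"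
  have diag: "s i i = 0" for i using skew[of i i] by simp
  have w4: "cycle_weight (\<lambda>i j. \<i> * complex_of_real (s i j)) w = complex_of_real (cycle_weight s w)"
    if "length w = 4" for w
    using that by (auto simp: length_Suc_conv eval_nat_numeral algebra_simps)
  have wA: "cycle_weight (\<lambda>i j. ?A $$ (i,j)) w = complex_of_real (cycle_weight s w)"
    if w: "length w = 4" "set w \<subseteq> {0..<n}" for w
  proof -
    obtain a v where av: "w = a # v" using w by (cases w) auto
    have "walk_weight (\<lambda>i j. ?A $$ (i,j)) a v a = walk_weight (\<lambda>i j. \<i> * complex_of_real (s i j)) a v a"
      by (rule walk_weight_cong) (use w av in \<open>auto simp: subset_iff\<close>)
    then show ?thesis using w4[OF w(1)] av by simp
  qed
  have wB: "cycle_weight (\<lambda>i j. ?B $$ (i,j)) w = cycle_weight (\<lambda>i j. if i = j then 0 else 1) w"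
    if w: "set w \<subseteq> {0..<n}" for w
  proof (cases w)
    case (Cons a v)
    have "walk_weight (\<lambda>i j. ?B $$ (i,j)) a v a = walk_weight (\<lambda>i j. if i = j then 0 else 1) a v a"
      by (rule walk_weight_cong) (use w Cons in \<open>auto simp: subset_iff Hn_def\<close>)
    then show ?thesis using Cons by simp
  qed simp
  have sq: "s i j * s j i = (if i = j then 0 else -1)" if "i < n" "j < n" for i j
    using one[OF that] skew[of i j] diag by auto
  have nd: "cycle_weight (\<lambda>i j. ?A $$ (i,j)) w = cycle_weight (\<lambda>i j. ?B $$ (i,j)) w"
    if w: "length w = 4" "set w \<subseteq> {0..<n}" "\<not> distinct w" for w
  proof -
    obtain a b c d where abcd: "w = [a,b,c,d]"
      using w(1) by (auto simp: length_Suc_conv eval_nat_numeral)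
    then have lt: "a < n" "b < n" "c < n" "d < n" using w by auto
    consider "a = b" | "b = c" | "c = d" | "d = a" | "a = c" | "b = d" using w(3) abcd by auto
    then have "cycle_weight s w = cycle_weight (\<lambda>i j. if i = j then 0 else 1) w"
    proof cases
      case 5
      have "cycle_weight s w = (s a b * s b a) * (s a d * s d a)" using abcd 5 by (simp add: mult.assoc)
      then show ?thesis using abcd 5 sq diag lt by simp
    next
      case 6
      have "cycle_weight s w = (s a b * s b a) * (s b c * s c b)" using abcd 6 by (simp add: mult_ac)
      then show ?thesis using abcd 6 sq diag lt by simp
    qed (use abcd diag in auto)
    moreover have "complex_of_real (cycle_weight (\<lambda>i j. if i = j then 0 else 1) w)
        = cycle_weight (\<lambda>i j. if i = j then 0 else 1) w"
      using abcd by simp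
    ultimately show ?thesis using wA[OF w(1,2)] wB[OF w(2)] by simp
  qed
  define V where "V = {1..<n}"
  have cardV: "card (V - {x,y}) = n - 3" if "x \<in> V" "y \<in> V" "x \<noteq> y" for x y
    using that by (simp add: V_def card_Diff_subset)
  have split: "(\<Sum>X | {0,x,y} \<subseteq> X \<and> X \<subseteq> {0..<n} \<and> card X = Suc 3. \<Sum>w \<in> permutations_of_set X.
      cycle_weight (\<lambda>i j. ?A $$ (i,j)) w - cycle_weight (\<lambda>i j. ?B $$ (i,j)) w)
    = complex_of_real (-8 * (\<Sum>z \<in> V - {x,y}. s x y * s y z + s y z * s z x + s z x * s x y) - 24 * real (n - 3))"
    if xy: "x \<in> V" "y \<in> V" "x \<noteq> y" for x y
  proof -
    have T: "{0,x,y} \<subseteq> {0..<n}" "card {0,x,y} = 3" and sub: "{0..<n} - {0,x,y} = V - {x,y}"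
      using xy n by (auto simp: V_def)
    have "(\<Sum>w \<in> permutations_of_set {z,0,x,y}.
        cycle_weight (\<lambda>i j. ?A $$ (i,j)) w - cycle_weight (\<lambda>i j. ?B $$ (i,j)) w)
      = complex_of_real (-8 * (s x y * s y z + s y z * s z x + s z x * s x y) - 24)"
      if z: "z \<in> V - {x,y}" for z
    proof -
      have d: "distinct [0,x,y,z]" using xy z by (auto simp: V_def)
      have s0': "s 0 x = 1" "s 0 y = 1" "s 0 z = 1" "s x 0 = -1" "s y 0 = -1" "s z 0 = -1"
        using s0 xy z skew[of 0] by (auto simp: V_def)
      have ins: "{z,0,x,y} = {0,x,y,z}" by auto
      \<comment> \<open>Every one of the 24 arrangements of a 4-set has weight 1 in the comparison matrix.\<close>
      have "cycle_weight (\<lambda>i j. ?A $$ (i,j)) w - cycle_weight (\<lambda>i j. ?B $$ (i,j)) w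
          = complex_of_real (cycle_weight s w - 1)"
        if w: "w \<in> permutations_of_set {0,x,y,z}" for w
      proof -
        have ws: "set w = {0,x,y,z}" "distinct w" using permutations_of_setD[OF w] by auto
        then have len: "length w = 4" using distinct_card[of w] d by simp
        have sub: "set w \<subseteq> {0..<n}" using ws xy z n by (auto simp: V_def)
        obtain a b c e where "w = [a,b,c,e]"
          using len by (auto simp: length_Suc_conv eval_nat_numeral)
        then have "cycle_weight (\<lambda>i j. if i = j then 0 else (1::complex)) w = 1"
          using ws(2) by auto
        then show ?thesis using wA[OF len sub] wB[OF sub] by simp
      qed
      then have "(\<Sum>w \<in> permutations_of_set {0,x,y,z}.
          cycle_weight (\<lambda>i j. ?A $$ (i,j)) w - cycle_weight (\<lambda>i j. ?B $$ (i,j)) w)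
        = complex_of_real (\<Sum>w \<in> permutations_of_set {0,x,y,z}. cycle_weight s w - 1)"
        by simp
      also have "(\<Sum>w \<in> permutations_of_set {0,x,y,z}. cycle_weight s w - 1)
          = (\<Sum>w \<in> permutations_of_set {0,x,y,z}. cycle_weight s w) - 24"
        using d by (simp add: sum_subtractf fact_numeral)
      also have "\<dots> = -8 * (s x y * s y z + s y z * s z x + s z x * s x y) - 24"
        unfolding sum_4_cycles_skew[OF skew d] s0'
        using skew[of x y] skew[of y z] skew[of z x] by (simp add: algebra_simps)
      finally show ?thesis unfolding ins .
    qed
    then have "(\<Sum>X | {0,x,y} \<subseteq> X \<and> X \<subseteq> {0..<n} \<and> card X = Suc (card {0,x,y}). \<Sum>w \<in> permutations_of_set X.
      cycle_weight (\<lambda>i j. ?A $$ (i,j)) w - cycle_weight (\<lambda>i j. ?B $$ (i,j)) w)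
     = (\<Sum>z \<in> V - {x,y}. complex_of_real (-8 * (s x y * s y z + s y z * s z x + s z x * s x y) - 24))"
      unfolding sum_supersets_Suc_card[OF finite_atLeastLessThan T(1)] sub by (rule sum.cong[OF refl])
    also have "\<dots> = complex_of_real (\<Sum>z \<in> V - {x,y}. -8 * (s x y * s y z + s y z * s z x + s z x * s x y) - 24)"
      by (rule of_real_sum[symmetric])
    also have "(\<Sum>z \<in> V - {x,y}. -8 * (s x y * s y z + s y z * s z x + s z x * s x y) - 24)
        = -8 * (\<Sum>z \<in> V - {x,y}. s x y * s y z + s y z * s z x + s z x * s x y) - 24 * real (n - 3)"
      by (simp only: sum_subtractf sum_distrib_left[symmetric] sum_constant cardV[OF xy])
    finally show ?thesis unfolding T(2) .
  qed
  let ?F = "\<lambda>x y. \<Sum>z \<in> V - {x,y}. s x y * s y z + s y z * s z x + s z x * s x y"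
  have const: "?F x y = ?F 1 2" if xy: "x \<in> V" "y \<in> V" "x \<noteq> y" for x y
  proof -
    have V12: "1 \<in> V" "2 \<in> V" "(1::nat) \<noteq> 2" using n by (auto simp: V_def)
    have "complex_of_real (-8 * ?F x y - 24 * real (n - 3)) = complex_of_real (-8 * ?F 1 2 - 24 * real (n - 3))"
      unfolding split[OF xy, symmetric] split[OF V12, symmetric]
    proof (rule monomorphic_cycle_design[OF _ mono _ Hn_spectrally_monomorphic n, where t = 3])
      show "Hn n 1 \<in> carrier_mat n n" by (simp add: Hn_def)
      show "cycle_weight (\<lambda>i j. ?A $$ (i,j)) w = cycle_weight (\<lambda>i j. ?B $$ (i,j)) w"
        if "length w = Suc 3" "set w \<subseteq> {0..<n}" "\<not> distinct w" for w
        using nd that by simp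
    qed (use xy n in \<open>auto simp: V_def\<close>)
    then show ?thesis by (simp only: of_real_eq_iff)
  qed
  show thesis by (rule that[folded V_def, OF const])
qed

section \<open>Tournaments\<close>

text \<open>Here \<open>s x y = 1\<close> means an edge from \<open>x\<close> to \<open>y\<close>, and \<open>t x y z\<close> is 4 on cyclic
triangles and 0 otherwise. A cyclic triangle at \<open>b\<close> uses exactly one outgoing and one incoming edge at \<open>b\<close>, hence
the sum of \<open>s b y * t b y z\<close> over \<open>y\<close> and \<open>z\<close> vanishes; as the sum over \<open>z\<close> alone is the
constant \<open>L \<noteq> 0\<close>, vertex \<open>b\<close> is balanced. For balanced tournaments the hypothesis
determines the inner product of two rows as \<open>2 - K\<close>, and since the column sums vanish as well,
summing the inner products with a fixed row gives \<open>(card V - 1) * (3 - K) = 0\<close>.\<close>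

lemma balanced_of_cyclic_design:
  fixes s :: "'a \<Rightarrow> 'a \<Rightarrow> real"
  assumes V: "finite V"
    and skew: "\<And>x y. s y x = - s x y"
    and one: "\<And>x y. x \<in> V \<Longrightarrow> y \<in> V \<Longrightarrow> x \<noteq> y \<Longrightarrow> s x y = 1 \<or> s x y = - 1"
    and K: "\<And>x y. x \<in> V \<Longrightarrow> y \<in> V \<Longrightarrow> x \<noteq> y \<Longrightarrow>
      (\<Sum>z \<in> V - {x,y}. s x y * s y z + s y z * s z x + s z x * s x y) = K"
    and cyc: "x0 \<in> V" "y0 \<in> V" "z0 \<in> V" "s x0 y0 = 1" "s y0 z0 = 1" "s z0 x0 = 1"
  shows "\<And>x. x \<in> V \<Longrightarrow> (\<Sum>z\<in>V. s x z) = 0"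
    and "\<And>x y. x \<in> V \<Longrightarrow> y \<in> V \<Longrightarrow> x \<noteq> y \<Longrightarrow> (\<Sum>z\<in>V. s x z * s y z) = - 1"
proof -
  define t where "t x y z = 1 + s x y * s y z + s y z * s z x + s z x * s x y" for x y z
  have diag: "s x x = 0" for x using skew[of x x] by simp
  have sq: "s x y * s x y = 1" if "x \<in> V" "y \<in> V" "x \<noteq> y" for x y using one[OF that] by auto
  have distinct: "x0 \<noteq> y0" "y0 \<noteq> z0" "z0 \<noteq> x0" using cyc diag by fastforce+
  define L where "L = real (card (V - {x0,y0})) + K"
  have card2: "card (V - {x,y}) = card V - 2" if "x \<in> V" "y \<in> V" "x \<noteq> y" for x y
    using that V by (simp add: card_Diff_subset)
  have L: "(\<Sum>z \<in> V - {x,y}. t x y z) = L" if "x \<in> V" "y \<in> V" "x \<noteq> y" for x y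
    using K[OF that] card2[OF that] card2[OF cyc(1,2) distinct(1)]
    by (simp add: t_def L_def sum.distrib add.assoc)
  have "0 < (\<Sum>z \<in> V - {x0,y0}. t x0 y0 z)"
  proof (rule sum_pos2[of _ z0])
    show "0 < t x0 y0 z0" using cyc by (simp add: t_def)
    show "0 \<le> t x0 y0 z" if "z \<in> V - {x0,y0}" for z
      using one[of y0 z] one[of z x0] cyc that by (auto simp: t_def)
  qed (use V cyc distinct in auto)
  then have L0: "L \<noteq> 0" using L[OF cyc(1,2) distinct(1)] by simp
  show D: "(\<Sum>z\<in>V. s b z) = 0" if b: "b \<in> V" for b
  proof -
    let ?W = "V - {b}"
    define G where "G y z = (if y = z then 0 else s b y * t b y z)" for y z
    \<comment> \<open>The outgoing edge of a triangle at \<open>b\<close> becomes incoming when \<open>y\<close> and \<open>z\<close> trade places.\<close>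
    have anti: "G y z + G z y = 0" if "y \<in> ?W" "z \<in> ?W" for y z
    proof (cases "y = z")
      case False
      define p q r where "p = s b y" and "q = s y z" and "r = s z b"
      have pqr: "p * p = 1" "q * q = 1" "r * r = 1"
        using that b False by (auto simp: p_def q_def r_def intro!: sq)
      have e: "s b z = - r" "s z y = - q" "s y b = - p" unfolding p_def q_def r_def by (rule skew)+
      have "G y z + G z y = p * (1 + p * q + q * r + r * p) + (- r) * (1 + r * q + q * p + p * r)"
        using False by (simp add: G_def t_def e p_def[symmetric] q_def[symmetric] r_def[symmetric])
      also have "\<dots> = p + (p * p) * q + p * q * r + (p * p) * r - r - (r * r) * q - p * q * r - (r * r) * p"
        by (simp add: algebra_simps)
      finally show ?thesis unfolding pqr by simp
    qed (simp add: G_def)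
    have "(\<Sum>y\<in>?W. \<Sum>z\<in>?W. G y z) + (\<Sum>y\<in>?W. \<Sum>z\<in>?W. G y z)
        = (\<Sum>y\<in>?W. \<Sum>z\<in>?W. G y z) + (\<Sum>y\<in>?W. \<Sum>z\<in>?W. G z y)"
      by (subst (2) sum.swap) simp
    also have "\<dots> = 0" unfolding sum.distrib[symmetric] using anti by simp
    finally have "(\<Sum>y\<in>?W. \<Sum>z\<in>?W. G y z) = 0" by simp
    moreover have "(\<Sum>z\<in>?W. G y z) = s b y * L" if y: "y \<in> ?W" for y
    proof -
      have eq: "?W - {y} = V - {b,y}" by auto
      have "(\<Sum>z\<in>?W. G y z) = (\<Sum>z\<in>?W - {y}. G y z)"
        using y V by (subst sum.remove[of _ y]) (auto simp: G_def)
      also have "\<dots> = s b y * (\<Sum>z \<in> V - {b,y}. t b y z)"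
        unfolding eq sum_distrib_left by (intro sum.cong refl) (auto simp: G_def)
      finally show ?thesis using L[of b y] y b by auto
    qed
    ultimately have "(\<Sum>y\<in>?W. s b y) * L = 0" by (simp add: sum_distrib_right)
    then have "(\<Sum>y\<in>?W. s b y) = 0" using L0 by simp
    then show ?thesis using b V diag by (subst sum.remove[of _ b]) auto
  qed
  have M: "(\<Sum>z\<in>V. s x z * s y z) = 2 - K" if xy: "x \<in> V" "y \<in> V" "x \<noteq> y" for x y
  proof -
    \<comment> \<open>Over all of \<open>V\<close> the two linear terms sum to zero; the terms at \<open>x\<close> and \<open>y\<close> account for the 2.\<close>
    let ?g = "\<lambda>z. s x y * s y z - s x y * s x z - s x z * s y z"
    have "K = (\<Sum>z \<in> V - {x,y}. ?g z)"
      unfolding K[OF xy, symmetric]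
    proof (rule sum.cong[OF refl])
      fix z
      show "s x y * s y z + s y z * s z x + s z x * s x y = ?g z"
        using skew[of x z] by (simp add: algebra_simps)
    qed
    also have "\<dots> = (\<Sum>z\<in>V. ?g z) - ?g x - ?g y"
    proof -
      have "V - {x} - {y} = V - {x,y}" by auto
      then show ?thesis using xy V sum.remove[of V x ?g] sum.remove[of "V - {x}" y ?g] by simp
    qed
    also have "?g x = - 1" using sq[OF xy] skew[of x y] diag by simp
    also have "?g y = - 1" using sq[OF xy] diag by simp
    also have "(\<Sum>z\<in>V. ?g z) = - (\<Sum>z\<in>V. s x z * s y z)"
      using D[OF xy(1)] D[OF xy(2)] by (simp add: sum_subtractf sum_distrib_left[symmetric])
    finally show ?thesis by simp
  qed
  have cV: "card V \<ge> 3"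
    using card_mono[OF V, of "{x0,y0,z0}"] cyc distinct by auto
  have "0 = (\<Sum>z\<in>V. s x0 z * (\<Sum>y\<in>V. s y z))"
  proof -
    have "(\<Sum>y\<in>V. s y z) = - (\<Sum>y\<in>V. s z y)" for z
      unfolding sum_negf[symmetric] by (rule sum.cong[OF refl]) (rule skew)
    then show ?thesis using D by simp
  qed
  also have "\<dots> = (\<Sum>y\<in>V. \<Sum>z\<in>V. s x0 z * s y z)"
    by (subst sum.swap) (simp add: sum_distrib_left)
  also have "\<dots> = (\<Sum>z\<in>V. s x0 z * s x0 z) + (\<Sum>y\<in>V - {x0}. \<Sum>z\<in>V. s x0 z * s y z)"
    by (rule sum.remove) (use V cyc in auto)
  also have "(\<Sum>z\<in>V. s x0 z * s x0 z) = (\<Sum>z\<in>V - {x0}. s x0 z * s x0 z)"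
    using V cyc diag by (subst sum.remove[of _ x0]) auto
  also have "\<dots> = (\<Sum>z\<in>V - {x0}. 1)"
    by (rule sum.cong[OF refl], rule sq) (use cyc in auto)
  also have "(\<Sum>y\<in>V - {x0}. \<Sum>z\<in>V. s x0 z * s y z) = (\<Sum>y\<in>V - {x0}. 2 - K)"
    by (rule sum.cong[OF refl], rule M) (use cyc in auto)
  finally have "real (card V - 1) * (3 - K) = 0"
    using V cyc by (simp add: algebra_simps)
  then have "K = 3" using cV by auto
  then show "(\<Sum>z\<in>V. s x z * s y z) = - 1" if "x \<in> V" "y \<in> V" "x \<noteq> y" for x y
    using M[OF that] by simp
qed

text \<open>The number of predecessors is strictly increasing along the edges, hence a bijection onto
\<open>{0..<n}\<close>; its inverse lists the vertices in order.\<close>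

lemma sort_transitive_tournament:
  assumes total: "\<And>i j. i < n \<Longrightarrow> j < n \<Longrightarrow> i \<noteq> j \<Longrightarrow> R i j \<or> R j i"
    and asym: "\<And>i j. R i j \<Longrightarrow> \<not> R j i"
    and trans: "\<And>i j k. i < n \<Longrightarrow> j < n \<Longrightarrow> k < n \<Longrightarrow> R i j \<Longrightarrow> R j k \<Longrightarrow> R i k"
  obtains p where "p permutes {0..<n::nat}" "\<And>i j. i < j \<Longrightarrow> j < n \<Longrightarrow> R (p i) (p j)"
proof -
  define rank where "rank i = (if i < n then card {l. l < n \<and> R l i} else i)" for i
  have mono: "rank i < rank j" if "i < n" "j < n" "R i j" for i j
  proof -
    have "{l. l < n \<and> R l i} \<subset> {l. l < n \<and> R l j}"
      using that trans asym by blast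
    then show ?thesis using that by (auto simp: rank_def intro!: psubset_card_mono)
  qed
  have lt: "rank i < n" if "i < n" for i
  proof -
    have "{l. l < n \<and> R l i} \<subset> {..<n}" using that asym by blast
    from psubset_card_mono[OF _ this] show ?thesis using that by (simp add: rank_def)
  qed
  have "inj_on rank {0..<n}"
    by (rule inj_onI, rule ccontr) (use total mono in fastforce)
  moreover have "rank ` {0..<n} \<subseteq> {0..<n}" using lt by auto
  ultimately have "bij_betw rank {0..<n} {0..<n}" by (simp add: bij_betw_def endo_inj_surj)
  then have r: "rank permutes {0..<n}" by (rule bij_imp_permutes) (simp add: rank_def)
  let ?p = "Hilbert_Choice.inv rank"
  have p: "?p permutes {0..<n}" by (rule permutes_inv[OF r])
  show thesis
  proof (rule that[OF p])
    fix i j assume ij: "i < j" "j < n"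
    have lt: "?p i < n" "?p j < n" using permutes_in_image[OF p] ij by auto
    have rp: "rank (?p i) = i" "rank (?p j) = j" using permutes_inverses(1)[OF r] by auto
    then have "\<not> R (?p j) (?p i)" "?p i \<noteq> ?p j" using mono[OF lt(2,1)] ij by auto
    then show "R (?p i) (?p j)" using total[OF lt] by blast
  qed
qed

section \<open>Classification\<close>

text \<open>Scaling by the phases of row 0 makes that row a positive constant \<open>r\<close>. The weight of a triangle
through 0 is then determined by the entry opposite to 0, so the constancy in length 3 says that all
these entries have the same real part; having the same modulus too, they agree up to conjugation. One
more phase \<open>c / r\<close> on index 0 makes row 0 equal to \<open>c\<close>, as it is in \<open>Hn n c\<close>.\<close>

lemma switching_normal_form:
  assumes n: "n \<ge> 7" and H: "hermitian_mat n H" and mono: "spectrally_monomorphic n (n - 3) H"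
  obtains c u and b :: real where "\<And>i. i < n \<Longrightarrow> cmod (u i) = 1"
    and "\<And>i. i < n \<Longrightarrow> u i * cnj (u i) * H $$ (i,i) + of_real b = 0"
    and "\<And>j. 0 < j \<Longrightarrow> j < n \<Longrightarrow> u 0 * cnj (u j) * H $$ (0,j) = c"
    and "\<And>i j. i < n \<Longrightarrow> j < n \<Longrightarrow> i \<noteq> j \<Longrightarrow> u i * cnj (u j) * H $$ (i,j) \<in> {c, cnj c}"
proof -
  have carr: "H \<in> carrier_mat n n" and herm: "\<And>i j. i < n \<Longrightarrow> j < n \<Longrightarrow> H $$ (j,i) = cnj (H $$ (i,j))"
    using H unfolding hermitian_mat_iff by blast+
  define b where "b = - Re (H $$ (0,0))"
  have diag: "H $$ (i,i) = complex_of_real (- b)" if "i < n" for i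
  proof -
    have "H $$ (i,i) = H $$ (0,0)" using monomorphic_diag_const[OF carr mono n that, of 0] n by simp
    moreover have "Im (H $$ (0,0)) = 0" using herm[of 0 0] n by (auto simp: complex_eq_iff)
    ultimately show ?thesis by (simp add: b_def complex_eq_iff)
  qed
  define h where "h i j = (if i = j then 0 else H $$ (i,j))" for i j
  define A where "A = mat n n (\<lambda>(i,j). h i j)"
  have hh: "h j i = cnj (h i j)" if "i < n" "j < n" for i j using herm[OF that] by (simp add: h_def)
  have A: "A \<in> carrier_mat n n" "hermitian_mat n A"
    unfolding hermitian_mat_iff by (simp_all add: A_def) (use hh in blast)
  have "Gamma_equivalent n H A"
    unfolding Gamma_equivalent_iff[OF H A(2)]
    by (rule exI[of _ 1], rule exI[of _ b], rule exI[of _ id], rule exI[of _ "\<lambda>i. 1"])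
      (auto simp: A_def h_def diag permutes_id)
  then have Amono: "spectrally_monomorphic n (n - 3) A"
    using Gamma_equivalent_spectrally_monomorphic mono by blast
  have A0: "A $$ (i,i) = 0" if "i < n" for i using that by (simp add: A_def h_def)
  define r where "r = cmod (h 0 1)"
  have mod: "cmod (h i j) = r" if "i < n" "j < n" "i \<noteq> j" for i j
  proof -
    have "h i j * cnj (h i j) = h 0 1 * cnj (h 0 1)"
      using monomorphic_pair_const[OF A(1) Amono n A0 that, of 0 1] that n hh[of i j] hh[of 0 1]
      by (simp add: A_def)
    then have "complex_of_real ((cmod (h i j))\<^sup>2) = complex_of_real (r\<^sup>2)"
      unfolding complex_norm_square r_def .
    then have "(cmod (h i j))\<^sup>2 = r\<^sup>2" by (simp only: of_real_eq_iff)
    then show ?thesis by (simp add: r_def)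
  qed
  show thesis
  proof (cases "r = 0")
    case True
    then have "H $$ (i,j) = 0" if "i < n" "j < n" "i \<noteq> j" for i j using mod[OF that] that by (simp add: h_def)
    then show thesis
      using that[of "\<lambda>i. 1" b 0] n diag by simp
  next
    case False
    then have r: "r > 0" by (simp add: r_def)
    define e where "e j = (if j = 0 then 1 else h 0 j / of_real r)" for j
    have e1: "cmod (e j) = 1" if "j < n" for j
      using mod[of 0 j] that r by (auto simp: e_def norm_divide)
    define w where "w i j = e i * cnj (e j) * h i j" for i j
    have w0: "w 0 j = of_real r" if "0 < j" "j < n" for j
    proof -
      have "cnj (h 0 j) * h 0 j = of_real (r\<^sup>2)"
        using mod[of 0 j] that complex_norm_square[of "h 0 j"] by (simp add: mult.commute)
      then show ?thesis using that r by (simp add: w_def e_def power2_eq_square)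
    qed
    have wmod: "cmod (w i j) = r" if "i < n" "j < n" "i \<noteq> j" for i j
      using e1 mod that by (simp add: w_def norm_mult)
    have wherm: "w j i = cnj (w i j)" if "i < n" "j < n" for i j
      using hh[OF that] by (simp add: w_def)
    define c where "c = w 1 2"
    have wRe: "Re (w i j) = Re c" if ij: "0 < i" "i < n" "0 < j" "j < n" "i \<noteq> j" for i j
    proof -
      have form: "w k l + cnj (w k l) = (A $$ (0,k) * A $$ (k,l) * A $$ (l,0) + A $$ (0,l) * A $$ (l,k) * A $$ (k,0))
          / (of_real r * of_real r)" if "0 < k" "k < n" "0 < l" "l < n" for k l
        using that hh[of 0 k] hh[of 0 l] hh[of k l] n r
        by (simp add: w_def e_def A_def field_simps)
      have "w i j + cnj (w i j) = w 1 2 + cnj (w 1 2)"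
        unfolding form[OF ij(1-4)] using form[of 1 2]
          monomorphic_triple_const[OF A(1) Amono n A0, of 0 i j 0 1 2] ij n by simp
      then show ?thesis by (simp add: c_def complex_add_cnj)
    qed
    have wc: "w i j = c \<or> w i j = cnj c" if ij: "0 < i" "i < n" "0 < j" "j < n" "i \<noteq> j" for i j
    proof -
      have "cmod (w i j) = cmod c" using wmod ij n by (simp add: c_def)
      then have "(Re (w i j))\<^sup>2 + (Im (w i j))\<^sup>2 = (Re c)\<^sup>2 + (Im c)\<^sup>2"
        by (simp add: cmod_def)
      then have "Im (w i j) = Im c \<or> Im (w i j) = - Im c"
        using wRe[OF ij] by (simp add: power2_eq_iff)
      then show ?thesis using wRe[OF ij] by (auto simp: complex_eq_iff)
    qed
    have cmodc: "cmod c = r" using wmod[of 1 2] n by (simp add: c_def)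
    define u where "u j = (if j = 0 then c / of_real r else e j)" for j
    show thesis
    proof (rule that[of u b c])
      show u1: "cmod (u i) = 1" if "i < n" for i
        using e1[OF that] cmodc r by (simp add: u_def norm_divide)
      show "u i * cnj (u i) * H $$ (i,i) + of_real b = 0" if "i < n" for i
        using u1[OF that] diag[OF that] by (simp add: complex_norm_square[symmetric])
      show u0: "u 0 * cnj (u j) * H $$ (0,j) = c" if "0 < j" "j < n" for j
      proof -
        have "u 0 * cnj (u j) * H $$ (0,j) = c / of_real r * w 0 j"
          using that by (simp add: u_def w_def e_def h_def)
        then show ?thesis using w0[OF that] r by simp
      qed
      show "u i * cnj (u j) * H $$ (i,j) \<in> {c, cnj c}" if ij: "i < n" "j < n" "i \<noteq> j" for i j
      proof -
        consider "i = 0" | "j = 0" "0 < i" | "0 < i" "0 < j" by blast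
        then show ?thesis
        proof cases
          case 1 then show ?thesis using u0[of j] ij by simp
        next
          case 2
          have "u i * cnj (u 0) * H $$ (i,0) = cnj (u 0 * cnj (u i) * H $$ (0,i))"
            using herm[of 0 i] ij 2 by simp
          then show ?thesis using u0[of i] ij 2 by simp
        next
          case 3
          then have "u i * cnj (u j) * H $$ (i,j) = w i j" using ij by (simp add: u_def w_def h_def)
          then show ?thesis using wc[of i j] 3 ij by auto
        qed
      qed
    qed
  qed
qed

lemma skew_conference_mat_of_orthogonal_rows:
  fixes s :: "nat \<Rightarrow> nat \<Rightarrow> real"
  assumes skew: "\<And>i j. s j i = - s i j"
    and one: "\<And>i j. i < n \<Longrightarrow> j < n \<Longrightarrow> i \<noteq> j \<Longrightarrow> s i j = 1 \<or> s i j = - 1"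
    and orth: "\<And>i j. i < n \<Longrightarrow> j < n \<Longrightarrow>
      (\<Sum>l = 0..<n. s i l * s j l) = (if i = j then real (n - 1) else 0)"
  shows "skew_conference_mat n (mat n n (\<lambda>(i,j). complex_of_real (s i j)))" (is "skew_conference_mat n ?S")
proof -
  have diag: "s i i = 0" for i using skew[of i i] by simp
  show ?thesis
    unfolding skew_conference_mat_def conference_mat_def
  proof (intro conjI allI impI)
    show "?S \<in> carrier_mat n n" by simp
    show "?S $$ (i,i) = 0" if "i < n" for i using that diag by simp
    show "?S $$ (i,j) \<in> {1, -1}" if "i < n" "j < n" "i \<noteq> j" for i j
      using one[OF that] that by auto
    show "transpose_mat ?S = - ?S"
    proof (rule eq_matI)
      fix i j assume "i < dim_row (- ?S)" "j < dim_col (- ?S)"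
      then show "transpose_mat ?S $$ (i,j) = (- ?S) $$ (i,j)"
        using skew[of i j] by simp
    qed auto
    show "transpose_mat ?S * ?S = of_nat (n - 1) \<cdot>\<^sub>m 1\<^sub>m n"
    proof (rule eq_matI)
      fix i j assume "i < dim_row (of_nat (n - 1) \<cdot>\<^sub>m 1\<^sub>m n :: complex mat)"
        "j < dim_col (of_nat (n - 1) \<cdot>\<^sub>m 1\<^sub>m n :: complex mat)"
      then have ij: "i < n" "j < n" by auto
      have "(transpose_mat ?S * ?S) $$ (i,j) = (\<Sum>l = 0..<n. complex_of_real (s l i) * complex_of_real (s l j))"
        using ij by (simp add: scalar_prod_def)
      also have "\<dots> = (\<Sum>l = 0..<n. complex_of_real (s i l * s j l))"
        by (rule sum.cong[OF refl], subst (1 2) skew) simp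
      also have "\<dots> = complex_of_real (\<Sum>l = 0..<n. s i l * s j l)" by simp
      finally show "(transpose_mat ?S * ?S) $$ (i,j) = (of_nat (n - 1) \<cdot>\<^sub>m 1\<^sub>m n) $$ (i,j)"
        unfolding orth[OF ij] using ij by simp
    qed auto
  qed
qed

text \<open>Removing row 0 leaves a tournament to which \<open>balanced_of_cyclic_design\<close> applies. Balance is the
orthogonality of row 0 to the other rows, and the inner products \<open>- 1\<close> are compensated by the
entries \<open>- 1\<close> in column 0.\<close>

lemma normalized_monomorphic_skew_imp_conference:
  fixes s :: "nat \<Rightarrow> nat \<Rightarrow> real"
  assumes mono: "spectrally_monomorphic n (n - 3) (mat n n (\<lambda>(i,j). \<i> * of_real (s i j)))"
    and n: "n \<ge> 7" and skew: "\<And>i j. s j i = - s i j"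
    and one: "\<And>i j. i < n \<Longrightarrow> j < n \<Longrightarrow> i \<noteq> j \<Longrightarrow> s i j = 1 \<or> s i j = - 1"
    and s0: "\<And>j. 0 < j \<Longrightarrow> j < n \<Longrightarrow> s 0 j = 1"
    and V: "x \<in> {1..<n}" "y \<in> {1..<n}" "z \<in> {1..<n}"
    and cyc: "s x y = 1" "s y z = 1" "s z x = 1"
  shows "skew_conference_mat n (mat n n (\<lambda>(i,j). complex_of_real (s i j)))"
proof -
  have diag: "s i i = 0" for i using skew[of i i] by simp
  obtain K where K: "\<And>x y. x \<in> {1..<n} \<Longrightarrow> y \<in> {1..<n} \<Longrightarrow> x \<noteq> y \<Longrightarrow>
      (\<Sum>z \<in> {1..<n} - {x,y}. s x y * s y z + s y z * s z x + s z x * s x y) = K"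
    by (rule monomorphic_skew_design[OF mono n skew one s0]) blast+
  have one': "s i j = 1 \<or> s i j = - 1" if "i \<in> {1..<n}" "j \<in> {1..<n}" "i \<noteq> j" for i j
    using one that by simp
  note bal = balanced_of_cyclic_design[of "{1..<n}" s K, OF _ skew one' K V cyc]
  have row0: "(\<Sum>l = 0..<n. f l) = f 0 + (\<Sum>l = 1..<n. f l)" for f :: "nat \<Rightarrow> real"
    using n by (simp add: sum.atLeast_Suc_lessThan)
  have orth: "(\<Sum>l = 0..<n. s i l * s j l) = (if i = j then real (n - 1) else 0)" if ij: "i < n" "j < n" for i j
  proof (cases "i = j")
    case True
    have "(\<Sum>l = 0..<n. s i l * s i l) = (\<Sum>l \<in> {0..<n} - {i}. s i l * s i l)"
      using ij diag by (subst sum.remove[of _ i]) auto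
    also have "\<dots> = (\<Sum>l \<in> {0..<n} - {i}. 1)"
      by (rule sum.cong[OF refl]) (use one[OF ij(1)] in fastforce)
    finally show ?thesis using True ij by simp
  next
    case False
    have zero: "(\<Sum>l = 0..<n. s 0 l * s k l) = 0" if "0 < k" "k < n" for k
    proof -
      have "(\<Sum>l = 1..<n. s 0 l * s k l) = (\<Sum>l = 1..<n. s k l)"
        by (rule sum.cong) (auto simp: s0)
      then show ?thesis using bal(1)[of k] that diag by (simp add: row0)
    qed
    consider "i = 0" "0 < j" | "j = 0" "0 < i" | "0 < i" "0 < j" using False by blast
    then show ?thesis
    proof cases
      case 1 then show ?thesis using zero[of j] ij False by simp
    next
      case 2 then show ?thesis using zero[of i] ij False by (simp add: mult.commute)
    next
      case 3
      then have "s i 0 = - 1" "s j 0 = - 1" using skew[of 0] s0 ij by auto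
      then show ?thesis using bal(2)[of i j] 3 ij False by (simp add: row0)
    qed
  qed
  show ?thesis by (rule skew_conference_mat_of_orthogonal_rows[OF skew one orth])
qed

text \<open>The normal form is read as a tournament with an edge from \<open>i\<close> to \<open>j\<close> when the entry is \<open>c\<close>; vertex
0 precedes all others, so it lies on no cyclic triangle. A cyclic triangle \<open>x, y, z\<close> has weight
\<open>c^3\<close> and the triangle \<open>0, x, y\<close> has weight \<open>c * c * cnj c\<close>. Twice the difference of their real
parts is \<open>(c - cnj c)^2 * (c + cnj c)\<close>.\<close>

lemma monomorphic_imp_Hn_or_conference:
  assumes n: "n \<ge> 7" and H: "hermitian_mat n H" and mono: "spectrally_monomorphic n (n - 3) H"
  shows "(\<exists>c. Gamma_equivalent n H (Hn n c)) \<or>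
    (\<exists>S. skew_conference_mat n S \<and> Gamma_equivalent n H (\<i> \<cdot>\<^sub>m S))"
proof -
  obtain c u and b :: real where u1: "\<And>i. i < n \<Longrightarrow> cmod (u i) = 1"
    and udiag: "\<And>i. i < n \<Longrightarrow> u i * cnj (u i) * H $$ (i,i) + of_real b = 0"
    and u0: "\<And>j. 0 < j \<Longrightarrow> j < n \<Longrightarrow> u 0 * cnj (u j) * H $$ (0,j) = c"
    and uc: "\<And>i j. i < n \<Longrightarrow> j < n \<Longrightarrow> i \<noteq> j \<Longrightarrow> u i * cnj (u j) * H $$ (i,j) \<in> {c, cnj c}"
    by (rule switching_normal_form[OF n H mono]) blast
  have herm: "\<And>i j. i < n \<Longrightarrow> j < n \<Longrightarrow> H $$ (j,i) = cnj (H $$ (i,j))"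
    using H unfolding hermitian_mat_iff by blast
  define w where "w i j = (if i = j then 0 else u i * cnj (u j) * H $$ (i,j))" for i j
  have wH: "w i j = u i * cnj (u j) * H $$ (i,j) + (if i = j then of_real b else 0)" if "i < n" "j < n" for i j
    using udiag[OF that(1)] by (auto simp: w_def)
  have w0: "w 0 j = c" if "0 < j" "j < n" for j using u0[OF that] that by (simp add: w_def)
  have wc: "w i j = c \<or> w i j = cnj c" if "i < n" "j < n" "i \<noteq> j" for i j
    using uc[OF that] that by (simp add: w_def)
  have wherm: "w j i = cnj (w i j)" if "i < n" "j < n" for i j
    using herm[OF that] by (simp add: w_def)
  have equiv: "Gamma_equivalent n H K"
    if K: "hermitian_mat n K" and a: "a \<noteq> 0" and p: "p permutes {0..<n}"
      and Kw: "\<And>i j. i < n \<Longrightarrow> j < n \<Longrightarrow> K $$ (i,j) = complex_of_real a * w (p i) (p j)" for K a p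
  proof -
    have pn: "p i < n" if "i < n" for i using permutes_in_image[OF p, of i] that by simp
    have peq: "p i = p j \<longleftrightarrow> i = j" for i j using permutes_inj[OF p] by (auto dest: injD)
    show ?thesis
      unfolding Gamma_equivalent_iff[OF H K]
      by (rule exI[of _ a], rule exI[of _ "a * b"], rule exI[of _ p], rule exI[of _ "u \<circ> p"])
        (use a p u1 pn in \<open>auto simp: Kw wH peq distrib_left\<close>)
  qed
  have Hn_case: ?thesis if p: "p permutes {0..<n}" and lt: "\<And>i j. i < j \<Longrightarrow> j < n \<Longrightarrow> w (p i) (p j) = c" for p
  proof -
    have pn: "p i < n" if "i < n" for i using permutes_in_image[OF p, of i] that by simp
    have "Gamma_equivalent n H (Hn n c)"
    proof (rule equiv[OF Hn_hermitian _ p, of 1])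
      fix i j assume ij: "i < n" "j < n"
      show "Hn n c $$ (i,j) = complex_of_real 1 * w (p i) (p j)"
        using ij lt[of i j] lt[of j i] wherm[of "p j" "p i"] pn
        by (cases i j rule: linorder_cases) (auto simp: Hn_def w_def)
    qed simp
    then show ?thesis by blast
  qed
  show ?thesis
  proof (cases "cnj c = c")
    case True
    show ?thesis
      by (rule Hn_case[OF permutes_id]) (use wc True in \<open>fastforce\<close>)
  next
    case nonreal: False
    define R where "R i j \<longleftrightarrow> i < n \<and> j < n \<and> i \<noteq> j \<and> w i j = c" for i j
    have asym: "\<not> R j i" if "R i j" for i j
      using that wherm[of i j] nonreal by (auto simp: R_def)
    have total: "R i j \<or> R j i" if "i < n" "j < n" "i \<noteq> j" for i j
      using wc[OF that] wherm[OF that(1,2)] that by (auto simp: R_def)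
    have R0: "\<not> R i 0" for i using asym[of 0 i] w0[of i] by (auto simp: R_def)
    show ?thesis
    proof (cases "\<exists>x y z. R x y \<and> R y z \<and> R z x")
      case False
      have trans: "R i k" if "i < n" "j < n" "k < n" "R i j" "R j k" for i j k
        using total[OF that(1,3)] that False asym by blast
      obtain p where "p permutes {0..<n}" "\<And>i j. i < j \<Longrightarrow> j < n \<Longrightarrow> R (p i) (p j)"
        by (rule sort_transitive_tournament[OF total asym trans]) blast+
      then show ?thesis by (intro Hn_case) (auto simp: R_def)
    next
      case True
      then obtain x y z where cyc: "R x y" "R y z" "R z x" by blast
      have pos: "x \<noteq> 0" "y \<noteq> 0" "z \<noteq> 0" using cyc R0 by metis+
      define W where "W = mat n n (\<lambda>(i,j). w i j)"
      have W: "W \<in> carrier_mat n n" "hermitian_mat n W"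
        unfolding hermitian_mat_iff by (simp_all add: W_def) (use wherm in blast)
      have Wmono: "spectrally_monomorphic n (n - 3) W"
        using Gamma_equivalent_spectrally_monomorphic[OF equiv[OF W(2) _ permutes_id, of 1]] mono
        by (simp add: W_def)
      have Wd: "W $$ (i,i) = 0" if "i < n" for i using that by (simp add: W_def w_def)
      have lt: "x < n" "y < n" "z < n" and ne: "x \<noteq> y" "y \<noteq> z" "z \<noteq> x" using cyc by (auto simp: R_def)
      have cw: "w x y = c" "w y z = c" "w z x = c" "w y x = cnj c" "w z y = cnj c" "w x z = cnj c"
        using cyc wherm[of x y] wherm[of y z] wherm[of z x] by (auto simp: R_def)
      have c0: "w 0 x = c" "w 0 y = c" "w x 0 = cnj c" "w y 0 = cnj c"
        using w0 wherm[of 0 x] wherm[of 0 y] lt pos by auto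
      have "c * c * c + cnj c * cnj c * cnj c = c * c * cnj c + c * cnj c * cnj c"
        using monomorphic_triple_const[OF W(1) Wmono n Wd lt ne, of 0 x y] lt ne pos cw c0 n
        by (simp add: W_def)
      then have "(c - cnj c) * (c - cnj c) * (c + cnj c) = 0"
        by (simp add: algebra_simps)
      then have "c + cnj c = 0" using nonreal by auto
      then have "Re c = 0" by (simp add: complex_add_cnj)
      then obtain \<gamma> where \<gamma>: "c = \<i> * complex_of_real \<gamma>" by (auto simp: complex_eq_iff intro!: that[of "Im c"])
      have \<gamma>0: "\<gamma> \<noteq> 0" using nonreal \<gamma> by auto
      define s where "s i j = (if i < n \<and> j < n then Re (w i j / c) else 0)" for i j
      have ws: "w i j = \<i> * complex_of_real (\<gamma> * s i j)" if "i < n" "j < n" for i j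
      proof (cases "i = j")
        case True then show ?thesis by (simp add: w_def s_def)
      next
        case False
        then show ?thesis using wc[OF that] that \<gamma>0 by (auto simp: s_def \<gamma>)
      qed
      have skew: "s j i = - s i j" for i j
      proof (cases "i < n \<and> j < n")
        case True
        then have "\<i> * complex_of_real (\<gamma> * s j i) = \<i> * complex_of_real (\<gamma> * (- s i j))"
          using wherm[of i j] ws[of i j] ws[of j i] by simp
        then have "\<gamma> * s j i = \<gamma> * (- s i j)"
          unfolding mult_cancel_left[of \<i>] of_real_eq_iff by simp
        then show ?thesis using \<gamma>0 mult_left_cancel[of \<gamma> "s j i" "- s i j"] by blast
      qed (auto simp: s_def)
      have one: "s i j = 1 \<or> s i j = - 1" if "i < n" "j < n" "i \<noteq> j" for i j
        using wc[OF that] that \<gamma>0 by (auto simp: s_def \<gamma>)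
      have sR: "s i j = 1" if "R i j" for i j
        using that \<gamma>0 by (auto simp: s_def R_def \<gamma>)
      define S where "S = mat n n (\<lambda>(i,j). complex_of_real (s i j))"
      have iS: "\<i> \<cdot>\<^sub>m S = mat n n (\<lambda>(i,j). \<i> * complex_of_real (s i j))"
        by (intro eq_matI) (auto simp: S_def)
      have Sherm: "hermitian_mat n (\<i> \<cdot>\<^sub>m S)"
        unfolding iS hermitian_mat_iff by (simp, intro allI impI, subst skew, simp)
      have SH: "Gamma_equivalent n H (\<i> \<cdot>\<^sub>m S)"
        by (rule equiv[OF Sherm _ permutes_id, of "1 / \<gamma>"]) (use \<gamma>0 ws in \<open>auto simp: iS\<close>)
      have Smono: "spectrally_monomorphic n (n - 3) (mat n n (\<lambda>(i,j). \<i> * complex_of_real (s i j)))"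
        using Gamma_equivalent_spectrally_monomorphic[OF SH] mono by (simp add: iS)
      have s0: "s 0 j = 1" if "0 < j" "j < n" for j
        by (rule sR) (use w0[OF that] that in \<open>auto simp: R_def\<close>)
      have V: "x \<in> {1..<n}" "y \<in> {1..<n}" "z \<in> {1..<n}" using lt pos by auto
      have "skew_conference_mat n S"
        unfolding S_def
        by (rule normalized_monomorphic_skew_imp_conference[OF Smono n skew one s0 V])
          (use cyc sR in auto)
      then show ?thesis using SH by blast
    qed
  qed
qed

theorem theorem4p2:
  fixes n :: nat and H :: "complex mat"
  assumes "n \<ge> 7" and "hermitian_mat n H"
  shows "spectrally_monomorphic n (n - 3) H \<longleftrightarrow>
    (\<exists>c::complex. Gamma_equivalent n H (Hn n c)) \<or>
    (\<exists>S. skew_conference_mat n S \<and> Gamma_equivalent n H (\<i> \<cdot>\<^sub>m S))"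
proof
  assume "spectrally_monomorphic n (n - 3) H"
  then show "(\<exists>c::complex. Gamma_equivalent n H (Hn n c)) \<or>
      (\<exists>S. skew_conference_mat n S \<and> Gamma_equivalent n H (\<i> \<cdot>\<^sub>m S))"
    by (rule monomorphic_imp_Hn_or_conference[OF assms])
next
  assume "(\<exists>c::complex. Gamma_equivalent n H (Hn n c)) \<or>
      (\<exists>S. skew_conference_mat n S \<and> Gamma_equivalent n H (\<i> \<cdot>\<^sub>m S))"
  then show "spectrally_monomorphic n (n - 3) H"
  proof (elim disjE exE conjE)
    fix c assume "Gamma_equivalent n H (Hn n c)"
    from Gamma_equivalent_spectrally_monomorphic[OF this] show ?thesis
      by (simp add: Hn_spectrally_monomorphic)
  next
    fix S assume S: "skew_conference_mat n S" and "Gamma_equivalent n H (\<i> \<cdot>\<^sub>m S)"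
    from Gamma_equivalent_spectrally_monomorphic[OF this(2)] show ?thesis
      using skew_conference_spectrally_monomorphic[OF S] assms(1) by simp
  qed
qed

end
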